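(* Let $\mathcal{G}$ be strongly connected, let each $f_i:\mathbb{R}^p\to\mathbb{R}$ ($i=1,\dots,n$) be convex with sub-gradients satisfying $\|\nabla f_i(\mathbf{x})\|\le D$ for all $\mathbf{x}\in\mathbb{R}^p$, and suppose that $f=\sum_{i=1}^n f_i$ attains its minimum $f^*$. Let $\{\mathbf{z}_i^k\}_{k\ge 0}$, $1\le i\le 2n$, be the sequences generated by the D-DGD algorithm with parameter $\epsilon\in(0,\Upsilon)$ and step-sizes $\alpha_k\ge 0$ satisfying $\sum_{k=0}^\infty\alpha_k=\infty$ and $\sum_{k=0}^\infty\alpha_k^2<\infty$. Then, for every agent $i\in\{1,\dots,n\}$, $$\lim_{k\to\infty} f(\mathbf{z}_i^k)=f^*.$$
   Context: Network: $\mathcal{G}=(\mathcal{V},\mathcal{E})$ is a directed graph on $n$ agents $\mathcal{V}=\{1,\dots,n\}$; $(i,j)\in\mathcal{E}$ means agent $j$ can send information to agent $i$. $\mathcal{N}_i^{\mathrm{in}}$ is the set of agents that can send information to $i$, and $\mathcal{N}_i^{\mathrm{out}}$ is the set of agents that can receive information from $i$; both are allowed to include $i$ itself. Weights: $A=\{a_{ij}\}\in\mathbb{R}^{n\times n}$ has $a_{ij}>0$ if $j\in\mathcal{N}_i^{\mathrm{in}}$, $a_{ij}=0$ otherwise, and $\sum_{j=1}^n a_{ij}=1$ for all $i$ (row-stochastic). $B=\{b_{ij}\}\in\mathbb{R}^{n\times n}$ has $b_{ij}>0$ if $i\in\mathcal{N}_j^{\mathrm{out}}$, $b_{ij}=0$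 otherwise, and $\sum_{i=1}^n b_{ij}=1$ for all $j$ (column-stochastic). For a scalar $\epsilon$, $$M=\begin{bmatrix}A & \epsilon I\\ I-A & B-\epsilon I\end{bmatrix}\in\mathbb{R}^{2n\times 2n}.$$ $\Upsilon=\frac{1}{(20+8n)^n}(1-|\lambda_3|)^n$, where $\lambda_3$ is the third largest eigenvalue in magnitude (with multiplicity) of the matrix $M$ obtained by setting $\epsilon=0$. Algorithm (D-DGD): from arbitrary initial vectors $\mathbf{x}_i^0,\mathbf{y}_i^0\in\mathbb{R}^p$, for $i=1,\dots,n$ and $k\ge 0$, $$\mathbf{x}_i^{k+1}=\sum_{j=1}^n a_{ij}\mathbf{x}_j^k+\epsilon\mathbf{y}_i^k-\alpha_k\nabla f_i(\mathbf{x}_i^k),\qquad \mathbf{y}_i^{k+1}=\mathbf{x}_i^k-\sum_{j=1}^n a_{ij}\mathbf{x}_j^k+\sum_{j=1}^n b_{ij}\mathbf{y}_j^k-\epsilon\mathbf{y}_i^k,$$ where $\nabla f_i(\mathbf{x})$ denotes a sub-gradient of $f_i$ at $\mathbf{x}$ ($f_i$ need not be differentiable). Set $\mathbf{z}_i^k=\mathbf{x}_i^k$ for $1\le i\le n$ and $\mathbf{z}_i^k=\mathbf{y}_{i-n}^k$ for $n+1\le i\le 2n$. Equivalently, $\mathbf{z}_i^{k+1}=\sum_{j=1}^{2n}[M]_{ij}\mathbf{z}_j^k-\alpha_k\mathbf{g}_i^k$ with $\mathbf{g}_i^k=\nabla f_i(\mathbf{x}_i^k)$ for $i\le n$ and $\mathbf{g}_i^k=\mathbf{0}$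 for $i>n$. $\|\cdot\|$ is the Euclidean norm. *)

theory Defs
  imports
    "HOL-Analysis.Analysis"
    "HOL-Computational_Algebra.Computational_Algebra"
    "Jordan_Normal_Form.Char_Poly"
    "Graph_Theory.Graph_Theory"
begin

text \<open>
  The agents are \<open>0, ..., n - 1\<close>. An arc \<open>(i, j)\<close> of the network means that agent \<open>j\<close> can send
  information to agent \<open>i\<close>, so an arc points against the flow of information. Loops are permitted
  but not required.
\<close>

definition network :: "nat \<Rightarrow> nat pair_pre_digraph \<Rightarrow> bool" where
  "network n G \<longleftrightarrow> pair_fin_digraph G \<and> pverts G = {..<n}"

definition in_nbrs :: "nat pair_pre_digraph \<Rightarrow> nat \<Rightarrow> nat set" where
  "in_nbrs G i = {j. (i, j) \<in> parcs G}"

definition out_nbrs :: "nat pair_pre_digraph \<Rightarrow> nat \<Rightarrow> nat set" where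
  "out_nbrs G j = {i. (i, j) \<in> parcs G}"

definition row_weights :: "nat \<Rightarrow> nat pair_pre_digraph \<Rightarrow> real mat \<Rightarrow> bool" where
  "row_weights n G A \<longleftrightarrow> A \<in> carrier_mat n n \<and>
     (\<forall>i<n. \<forall>j<n. if j \<in> in_nbrs G i then A $$ (i, j) > 0 else A $$ (i, j) = 0) \<and>
     (\<forall>i<n. (\<Sum>j<n. A $$ (i, j)) = 1)"

definition column_weights :: "nat \<Rightarrow> nat pair_pre_digraph \<Rightarrow> real mat \<Rightarrow> bool" where
  "column_weights n G B \<longleftrightarrow> B \<in> carrier_mat n n \<and>
     (\<forall>i<n. \<forall>j<n. if i \<in> out_nbrs G j then B $$ (i, j) > 0 else B $$ (i, j) = 0) \<and>
     (\<forall>j<n. (\<Sum>i<n. B $$ (i, j)) = 1)"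

definition M_matrix :: "nat \<Rightarrow> real mat \<Rightarrow> real mat \<Rightarrow> real \<Rightarrow> real mat" where
  "M_matrix n A B \<epsilon> =
     four_block_mat A (\<epsilon> \<cdot>\<^sub>m 1\<^sub>m n) (1\<^sub>m n - A) (B - \<epsilon> \<cdot>\<^sub>m 1\<^sub>m n)"

text \<open>
  The moduli of the complex eigenvalues of a real matrix, in decreasing order; each eigenvalue is
  counted with its algebraic multiplicity.
\<close>

definition eigenvalue_moduli :: "real mat \<Rightarrow> real list" where
  "eigenvalue_moduli M =
     rev (sorted_list_of_multiset
       (image_mset cmod (proots (char_poly (map_mat complex_of_real M)))))"

text \<open>
  The number \<open>|\<lambda>\<^sub>3|\<close>. For \<open>n = 1\<close> the matrix has just two eigenvalues; the value is then taken to be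
  0, which yields the largest possible parameter range below.
\<close>

definition third_modulus :: "real mat \<Rightarrow> real" where
  "third_modulus M =
     (let ms = eigenvalue_moduli M in if length ms \<ge> 3 then ms ! 2 else 0)"

definition Upsilon :: "nat \<Rightarrow> real mat \<Rightarrow> real mat \<Rightarrow> real" where
  "Upsilon n A B =
     1 / (20 + 8 * real n) ^ n * (1 - third_modulus (M_matrix n A B 0)) ^ n"

definition subgradients :: "('a::real_inner \<Rightarrow> real) \<Rightarrow> 'a \<Rightarrow> 'a set" where
  "subgradients h x = {g. \<forall>y. h y \<ge> h x + inner g (y - x)}"

text \<open>
  Below, \<open>x k i\<close> and \<open>y k i\<close> are the vectors held by agent \<open>i\<close> at step \<open>k\<close>, and \<open>g k i\<close> is the
  subgradient it uses there. Any subgradient may be picked at each step, also different ones on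
  returning to the same point; a fixed selection \<open>x \<mapsto> \<nabla>f\<^sub>i(x)\<close> is a special case.
\<close>

definition d_dgd ::
  "nat \<Rightarrow> real mat \<Rightarrow> real mat \<Rightarrow> real \<Rightarrow> (nat \<Rightarrow> real) \<Rightarrow>
   (nat \<Rightarrow> 'a::real_inner \<Rightarrow> real) \<Rightarrow> (nat \<Rightarrow> nat \<Rightarrow> 'a) \<Rightarrow> (nat \<Rightarrow> nat \<Rightarrow> 'a) \<Rightarrow>
   (nat \<Rightarrow> nat \<Rightarrow> 'a) \<Rightarrow> bool" where
  "d_dgd n A B \<epsilon> \<alpha> f g x y \<longleftrightarrow>
     (\<forall>k. \<forall>i<n.
        g k i \<in> subgradients (f i) (x k i) \<and>
        x (Suc k) i =
          (\<Sum>j<n. A $$ (i, j) *\<^sub>R x k j) + \<epsilon> *\<^sub>R y k i - \<alpha> k *\<^sub>R g k i \<and>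
        y (Suc k) i =
          x k i - (\<Sum>j<n. A $$ (i, j) *\<^sub>R x k j) + (\<Sum>j<n. B $$ (i, j) *\<^sub>R y k j)
            - \<epsilon> *\<^sub>R y k i)"

definition stacked ::
  "nat \<Rightarrow> (nat \<Rightarrow> nat \<Rightarrow> 'a) \<Rightarrow> (nat \<Rightarrow> nat \<Rightarrow> 'a) \<Rightarrow> nat \<Rightarrow> nat \<Rightarrow> 'a" where
  "stacked n x y k i = (if i < n then x k i else y k (i - n))"

end

theory Submission
  imports
    Defs
    "Jordan_Normal_Form.Schur_Decomposition"
    "Jordan_Normal_Form.Spectral_Radius"
    "Jordan_Normal_Form.Jordan_Normal_Form_Existence"
begin

text \<open>
  Away from its simple eigenvalue 1, \<open>M\<close> has spectral radius less than 1. To see this, let \<open>(u, w)\<close>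
  be an eigenvector with entry sum 0 for an eigenvalue \<open>z\<close> with \<open>|z| \<ge> 1\<close>. Let \<open>p\<close> and \<open>v\<close> be
  the Perron vectors of \<open>A\<close> and \<open>B\<close> and write \<open>u = c 1 + u'\<close>, \<open>w = s v + w'\<close> accordingly. The parts
  \<open>u'\<close> and \<open>w'\<close> are controlled by the resolvents of \<open>A\<close> and \<open>B\<close> on the kernels of \<open>p\<close> and \<open>1\<close>.
  Since \<open>A\<close> and \<open>B\<close> are contractions in the sup and sum norm, a Blaschke product argument bounds these
  resolvents by a constant times \<open>1 / (1 - |\<lambda>\<^sub>3|)\<close>, rather than by the power \<open>n - 1\<close> of it that comes from
  the adjugate. Pairing with \<open>p\<close> gives \<open>((z - 1) / \<epsilon> + n p\<^sup>Tv) c\<close> up to small errors, and the two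
  terms in the bracket cannot cancel because \<open>|z| \<ge> 1\<close>; hence \<open>c = 0\<close> and everything vanishes.

  The average \<open>\<^bold>z\<close> of all \<open>2n\<close> states, scaled by 2, therefore performs a subgradient step with error
  terms that are convolutions of the step sizes with a geometric sequence, hence square summable.
  The usual distance estimate yields \<open>\<Sum> \<alpha>\<^sub>k (f(\<^bold>z\<^sup>k) - f*) < \<infinity>\<close>, and as \<open>f(\<^bold>z\<^sup>k)\<close> changes by at most a
  multiple of \<open>\<alpha>\<^sub>k\<close> in each step, it converges to \<open>f*\<close>.
\<close>

section \<open>Subgradients and slowly varying sequences\<close>

text \<open>Separate \<open>(x, h x)\<close> from the strict epigraph. A vertical hyperplane would
  be violated above \<open>x - a\<close>, so the normal \<open>(a, \<beta>)\<close> has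
  \<open>\<beta> > 0\<close> and gives the slope \<open>- a / \<beta>\<close>. Existence at every
  point is what turns the bound on subgradients into a Lipschitz bound for each
  \<open>f i\<close>.\<close>

lemma subgradient_exists:
  fixes h :: "'a::euclidean_space \<Rightarrow> real"
  assumes "convex_on UNIV h"
  obtains v where "v \<in> subgradients h x"
proof -
  let ?T = "{p. h (fst p) < snd p}"
  have "convex ?T"
  proof (rule convexI)
    fix p q :: "'a \<times> real" and s t :: real
    assume pq: "p \<in> ?T" "q \<in> ?T" and st: "0 \<le> s" "0 \<le> t" "s + t = 1"
    have "h (s *\<^sub>R fst p + t *\<^sub>R fst q) \<le> s * h (fst p) + t * h (fst q)"
      using assms st unfolding convex_on_def by blast
    also have "\<dots> < s * snd p + t * snd q"
    proof (cases "s = 0")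
      case True
      with pq st show ?thesis by simp
    next
      case False
      then have "s * h (fst p) < s * snd p" using pq st by simp
      moreover have "t * h (fst q) \<le> t * snd q" using pq st by (simp add: mult_left_mono)
      ultimately show ?thesis by linarith
    qed
    finally show "s *\<^sub>R p + t *\<^sub>R q \<in> ?T" by simp
  qed
  moreover have "?T \<noteq> {}" by (auto intro!: exI[of _ x] exI[of _ "h x + 1"])
  moreover have "{(x, h x)} \<inter> ?T = {}" by simp
  ultimately obtain c b where c: "c \<noteq> 0" "\<forall>p\<in>{(x, h x)}. inner c p \<le> b" "\<forall>p\<in>?T. inner c p \<ge> b"
    using separating_hyperplane_sets[of "{(x, h x)}" ?T] by auto
  obtain a \<beta> where ab: "c = (a, \<beta>)" by (cases c)
  have sep: "inner a x + \<beta> * h x \<le> inner a y + \<beta> * t" if "h y < t" for y t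
  proof -
    have "(y, t) \<in> ?T" using that by simp
    with c have "inner c (x, h x) \<le> inner c (y, t)" by force
    then show ?thesis by (simp add: ab)
  qed
  have "\<beta> \<noteq> 0"
  proof
    assume "\<beta> = 0"
    then have "inner a x \<le> inner a (x - a)" using sep[of "x - a" "h (x - a) + 1"] by simp
    then have "inner a a \<le> 0" by (simp add: inner_diff_right)
    then have "a = 0" using inner_gt_zero_iff[of a] by linarith
    with \<open>\<beta> = 0\<close> c(1) ab show False by (simp add: zero_prod_def)
  qed
  moreover have "\<beta> \<ge> 0" using sep[of x "h x + 1"] by (simp add: algebra_simps)
  ultimately have "\<beta> > 0" by simp
  \<comment> \<open>Separation speaks only of points strictly above the graph, hence the slack
    \<open>e\<close>.\<close>
  have "h y \<ge> h x + inner ((- 1 / \<beta>) *\<^sub>R a) (y - x)" for y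
  proof (rule field_le_epsilon)
    fix e :: real assume "e > 0"
    have "\<beta> * (h x + inner ((- 1 / \<beta>) *\<^sub>R a) (y - x)) = inner a x + \<beta> * h x - inner a y"
      using \<open>\<beta> > 0\<close> by (simp add: distrib_left inner_diff_right right_diff_distrib)
    also have "\<dots> \<le> \<beta> * (h y + e)" using sep[of y "h y + e"] \<open>e > 0\<close> by simp
    finally show "h x + inner ((- 1 / \<beta>) *\<^sub>R a) (y - x) \<le> h y + e"
      using \<open>\<beta> > 0\<close> by simp
  qed
  then have "(- 1 / \<beta>) *\<^sub>R a \<in> subgradients h x" by (simp only: subgradients_def mem_Collect_eq) blast
  then show thesis by (rule that)
qed

text \<open>Summing the recursion bounds a partial sum of \<open>s\<close> by
  \<open>\<gamma>\<close> times itself plus a constant; as \<open>\<gamma> < 1\<close>, this can be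
  solved for the partial sum.\<close>

lemma summable_of_contraction:
  fixes s b :: "nat \<Rightarrow> real"
  assumes step: "\<And>k. s (Suc k) \<le> \<gamma> * s k + b k"
    and s0: "\<And>k. 0 \<le> s k" and b0: "\<And>k. 0 \<le> b k" and b: "summable b"
    and \<gamma>: "0 \<le> \<gamma>" "\<gamma> < 1"
  shows "summable s"
proof (rule bounded_imp_summable[OF s0])
  fix K
  have "(\<Sum>k\<le>K. s k) = s 0 + (\<Sum>k<K. s (Suc k))" 
    by (simp add: sum.atMost_shift)
  also have "(\<Sum>k<K. s (Suc k)) \<le> (\<Sum>k<K. \<gamma> * s k + b k)" by (intro sum_mono step)
  also have "\<dots> = \<gamma> * (\<Sum>k<K. s k) + (\<Sum>k<K. b k)" by (simp add: sum.distrib sum_distrib_left)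
  also have "\<dots> \<le> \<gamma> * (\<Sum>k\<le>K. s k) + suminf b"
    using sum_le_suminf[OF b] b0 \<gamma> by (intro add_mono mult_left_mono sum_mono2) (auto simp: s0)
  finally have "(1 - \<gamma>) * (\<Sum>k\<le>K. s k) \<le> s 0 + suminf b" by (simp add: algebra_simps)
  then show "(\<Sum>k\<le>K. s k) \<le> (s 0 + suminf b) / (1 - \<gamma>)"
    using \<gamma> by (simp add: pos_le_divide_eq mult.commute)
qed

lemma summable_square_imp_tendsto_0:
  fixes a :: "nat \<Rightarrow> real"
  assumes "summable (\<lambda>k. (a k)\<^sup>2)"
  shows "a \<longlonglongrightarrow> 0"
proof -
  have "(\<lambda>k. sqrt ((a k)\<^sup>2)) \<longlonglongrightarrow> sqrt 0"
    by (intro tendsto_real_sqrt summable_LIMSEQ_zero assms)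
  then show ?thesis by (simp add: tendsto_rabs_zero_iff)
qed

lemma summable_mult_of_squares:
  fixes a b :: "nat \<Rightarrow> real"
  assumes "summable (\<lambda>k. (a k)\<^sup>2)" "summable (\<lambda>k. (b k)\<^sup>2)"
  shows "summable (\<lambda>k. a k * b k)"
proof (rule summable_comparison_test[OF _ summable_add[OF assms]], intro exI allI impI)
  fix k
  have "2 * (\<bar>a k\<bar> * \<bar>b k\<bar>) \<le> (a k)\<^sup>2 + (b k)\<^sup>2"
    using sum_squares_bound[of "\<bar>a k\<bar>" "\<bar>b k\<bar>"] by simp
  moreover have "0 \<le> \<bar>a k\<bar> * \<bar>b k\<bar>" by simp
  ultimately show "norm (a k * b k) \<le> (a k)\<^sup>2 + (b k)\<^sup>2" unfolding real_norm_def abs_mult by linarith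
qed

text \<open>\<open>E (Suc k)\<close> is the convex combination of \<open>E k\<close> and
  \<open>C * \<alpha> k / (1 - \<gamma>)\<close> with weights \<open>\<gamma>\<close> and
  \<open>1 - \<gamma>\<close>. By convexity of the square, the squares again satisfy a contracting
  recursion, now with a summable perturbation.\<close>

lemma summable_squares_of_contraction:
  fixes E \<alpha> :: "nat \<Rightarrow> real"
  assumes step: "\<And>k. E (Suc k) = \<gamma> * E k + C * \<alpha> k"
    and \<alpha>: "summable (\<lambda>k. (\<alpha> k)\<^sup>2)" and \<gamma>: "0 \<le> \<gamma>" "\<gamma> < 1"
  shows "summable (\<lambda>k. (E k)\<^sup>2)"
proof (rule summable_of_contraction[OF _ _ _ _ \<gamma>])
  fix k
  let ?a = "C * \<alpha> k / (1 - \<gamma>)"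
  have sq: "(\<gamma> * s + (1 - \<gamma>) * t)\<^sup>2 = \<gamma> * s\<^sup>2 + (1 - \<gamma>) * t\<^sup>2 - \<gamma> * (1 - \<gamma>) * (s - t)\<^sup>2" for s t :: real
    by (simp add: power2_eq_square algebra_simps)
  have "E (Suc k) = \<gamma> * E k + (1 - \<gamma>) * ?a" using \<gamma> by (simp add: step)
  then have "(E (Suc k))\<^sup>2 = (\<gamma> * E k + (1 - \<gamma>) * ?a)\<^sup>2" by (rule arg_cong)
  also have "\<dots> = \<gamma> * (E k)\<^sup>2 + (1 - \<gamma>) * ?a\<^sup>2 - \<gamma> * (1 - \<gamma>) * (E k - ?a)\<^sup>2" by (rule sq)
  also have "\<dots> \<le> \<gamma> * (E k)\<^sup>2 + (1 - \<gamma>) * ?a\<^sup>2"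
    using \<gamma> by (simp only: diff_le_eq le_add_same_cancel1) simp
  also have "(1 - \<gamma>) * ?a\<^sup>2 = C\<^sup>2 / (1 - \<gamma>) * (\<alpha> k)\<^sup>2"
  proof -
    have "d * (c / d)\<^sup>2 = c\<^sup>2 / d" if "d \<noteq> 0" for c d :: real
      using that by (simp add: power2_eq_square)
    from this[of "1 - \<gamma>"] show ?thesis using \<gamma> by (simp add: power_mult_distrib)
  qed
  finally show "(E (Suc k))\<^sup>2 \<le> \<gamma> * (E k)\<^sup>2 + C\<^sup>2 / (1 - \<gamma>) * (\<alpha> k)\<^sup>2" .
next
  show "summable (\<lambda>k. C\<^sup>2 / (1 - \<gamma>) * (\<alpha> k)\<^sup>2)" using \<alpha> by (rule summable_mult)
qed (use \<gamma> in auto)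

text \<open>Since the steps have infinite sum, \<open>a\<close> must return below any level
  \<open>\<eta>\<close>. A later rise from below \<open>\<eta>\<close> to \<open>2 * \<eta>\<close>
  needs total step length about \<open>\<eta> / C\<close>, all of it spent where \<open>a\<close> is
  at least \<open>\<eta>\<close> apart from the first step. The tails of the convergent series of
  \<open>\<alpha> k * a k\<close> do not allow this.\<close>

lemma tendsto_0_of_slow_variation:
  fixes a \<alpha> :: "nat \<Rightarrow> real"
  assumes a0: "\<And>k. 0 \<le> a k" and \<alpha>0: "\<And>k. 0 \<le> \<alpha> k"
    and \<alpha>: "\<alpha> \<longlonglongrightarrow> 0" and div: "filterlim (\<lambda>K. \<Sum>k<K. \<alpha> k) at_top sequentially"
    and sm: "summable (\<lambda>k. \<alpha> k * a k)"
    and var: "\<And>k. a (Suc k) - a k \<le> C * \<alpha> k" and C: "C > 0"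
  shows "a \<longlonglongrightarrow> 0"
proof (rule LIMSEQ_I)
  fix r :: real assume "0 < r"
  define \<eta> where "\<eta> = r / 2"
  have \<eta>: "\<eta> > 0" "r = 2 * \<eta>" using \<open>0 < r\<close> by (simp_all add: \<eta>_def)
  \<comment> \<open>Calibrated so that after division by \<open>\<eta>\<close> and multiplication by
    \<open>C\<close> the tail accounts for at most half of a rise by \<open>\<eta>\<close>. The
    other half is reserved for a single step, controlled by \<open>K2\<close>.\<close>
  obtain K1 where K1: "\<And>m n. m \<ge> K1 \<Longrightarrow> norm (\<Sum>k=m..<n. \<alpha> k * a k) < \<eta>\<^sup>2 / (2 * C)"
    using sm[unfolded summable_Cauchy] \<eta>(1) C
    by (metis mult_pos_pos zero_less_divide_iff zero_less_numeral zero_less_power)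
  obtain K2 where K2: "\<And>k. k \<ge> K2 \<Longrightarrow> \<alpha> k < \<eta> / (2 * C)"
  proof -
    have "eventually (\<lambda>k. \<alpha> k < \<eta> / (2 * C)) sequentially"
      using \<eta>(1) C by (intro order_tendstoD(2)[OF \<alpha>]) simp
    then show thesis using that by (auto simp: eventually_sequentially)
  qed
  define K where "K = max K1 K2"
  obtain m where m: "m \<ge> K" "a m < \<eta>"
  proof -
    have "\<exists>m\<ge>K. a m < \<eta>"
    proof (rule ccontr)
      assume "\<not> ?thesis"
      then have big: "\<And>k. k \<ge> K \<Longrightarrow> a k \<ge> \<eta>" by force
      have "summable \<alpha>"
      proof (rule summable_comparison_test)
        show "\<exists>N. \<forall>k\<ge>N. norm (\<alpha> k) \<le> (\<alpha> k * a k) / \<eta>"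
          using big \<alpha>0 \<eta> by (intro exI[of _ K]) (simp add: pos_le_divide_eq mult_left_mono)
        show "summable (\<lambda>k. (\<alpha> k * a k) / \<eta>)" using sm by (rule summable_divide)
      qed
      then have bd: "(\<Sum>k<n. \<alpha> k) \<le> suminf \<alpha>" for n by (rule sum_le_suminf) (auto simp: \<alpha>0)
      have "eventually (\<lambda>n. (\<Sum>k<n. \<alpha> k) > suminf \<alpha>) sequentially"
        using div by (simp add: filterlim_at_top_dense)
      with bd show False by (auto simp: eventually_sequentially not_less[symmetric])
    qed
    then show thesis using that by blast
  qed
  have "a k < r" if "k \<ge> m" for k
  proof (rule ccontr)
    assume ak: "\<not> a k < r"
    \<comment> \<open>\<open>j\<close> will be the last index up to \<open>k\<close> at which
      \<open>a\<close> is below \<open>\<eta>\<close>. From there to \<open>k\<close> the steps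
      satisfy \<open>\<alpha> i \<le> \<alpha> i * a i / \<eta>\<close>, except for the step at
      \<open>j\<close> itself.\<close>
    define J where "J = {j. m \<le> j \<and> j \<le> k \<and> a j < \<eta>}"
    have "finite J" "m \<in> J" using that m by (auto simp: J_def)
    define j where "j = Max J"
    have "j \<in> J" unfolding j_def using \<open>finite J\<close> \<open>m \<in> J\<close> by (intro Max_in) auto
    have above: "a i \<ge> \<eta>" if "j < i" "i \<le> k" for i
    proof (rule ccontr)
      assume "\<not> ?thesis"
      with that \<open>j \<in> J\<close> have "i \<in> J" by (auto simp: J_def)
      then have "i \<le> j" unfolding j_def using \<open>finite J\<close> by simp
      with that show False by simp
    qed
    have j: "m \<le> j" "j \<le> k" "a j < \<eta>" using \<open>j \<in> J\<close> by (auto simp: J_def)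
    have "j < k" using j ak \<eta> by (metis le_neq_implies_less less_trans mult_2 less_add_same_cancel1)
    have "a k - a j = (\<Sum>i=j..<k. a (Suc i) - a i)" using j(2) by (simp add: sum_Suc_diff')
    also have "\<dots> \<le> (\<Sum>i=j..<k. C * \<alpha> i)" by (intro sum_mono var)
    also have "\<dots> = C * \<alpha> j + C * (\<Sum>i=Suc j..<k. \<alpha> i)"
      using \<open>j < k\<close> by (simp add: sum.atLeast_Suc_lessThan sum_distrib_left)
    also have "(\<Sum>i=Suc j..<k. \<alpha> i) \<le> (\<Sum>i=Suc j..<k. \<alpha> i * a i / \<eta>)"
      using above \<alpha>0 \<eta> by (intro sum_mono) (simp add: pos_le_divide_eq mult_left_mono)
    also have "\<dots> = (\<Sum>i=Suc j..<k. \<alpha> i * a i) / \<eta>" by (simp add: sum_divide_distrib)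
    also have "\<dots> \<le> (\<eta>\<^sup>2 / (2 * C)) / \<eta>"
      using K1[of "Suc j" k] m j \<eta> by (intro divide_right_mono) (auto simp: K_def)
    also have "\<dots> = \<eta> / (2 * C)" using \<eta> by (simp add: power2_eq_square)
    also have "C * \<alpha> j + C * (\<eta> / (2 * C)) < C * (\<eta> / (2 * C)) + C * (\<eta> / (2 * C))"
      using K2[of j] m j C by (intro add_strict_right_mono mult_strict_left_mono) (auto simp: K_def)
    also have "\<dots> = \<eta>" using C by (simp add: field_simps)
    finally show False using C j ak \<eta> by (simp add: mult_left_mono)
  qed
  then show "\<exists>no. \<forall>k\<ge>no. norm (a k - 0) < r" using a0 by auto
qed

text \<open>A subgradient method for \<open>zb\<close> whose subgradients are taken at points within
  \<open>E k\<close> of \<open>zb k\<close>. The resulting errors are multiples of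
  \<open>\<alpha> k * E k\<close>, so square summability of both factors makes them summable. Since
  \<open>F (zb k)\<close> moves by at most a multiple of \<open>\<alpha> k\<close> per step,
  summability of \<open>\<alpha> k * a k\<close> can be upgraded to convergence.\<close>

lemma distributed_subgradient_convergence:
  fixes f :: "nat \<Rightarrow> 'a::euclidean_space \<Rightarrow> real" and x g :: "nat \<Rightarrow> nat \<Rightarrow> 'a" and zb :: "nat \<Rightarrow> 'a"
  assumes n: "n > 0"
    and convex: "\<And>i. i < n \<Longrightarrow> convex_on UNIV (f i)"
    and bound: "\<And>i u v. i < n \<Longrightarrow> v \<in> subgradients (f i) u \<Longrightarrow> norm v \<le> D"
    and F: "F = (\<lambda>u. \<Sum>i<n. f i u)"
    and xs: "F xs = fstar" and minimal: "\<And>u. fstar \<le> F u"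
    and \<alpha>0: "\<And>k. 0 \<le> \<alpha> k"
    and div: "filterlim (\<lambda>K. \<Sum>k<K. \<alpha> k) at_top sequentially"
    and sq: "summable (\<lambda>k. (\<alpha> k)\<^sup>2)"
    and g: "\<And>k i. i < n \<Longrightarrow> g k i \<in> subgradients (f i) (x k i)"
    and zb: "\<And>k. zb (Suc k) = zb k - (\<alpha> k / n) *\<^sub>R (\<Sum>i<n. g k i)"
    and near: "\<And>k i. i < n \<Longrightarrow> norm (x k i - zb k) \<le> E k"
    and E: "summable (\<lambda>k. (E k)\<^sup>2)"
    and i: "i < n"
  shows "(\<lambda>k. F (x k i)) \<longlonglongrightarrow> fstar"
proof -
  have gD: "norm (g k i) \<le> D" if "i < n" for k i using bound[OF that g[OF that]] .
  have D0: "0 \<le> D" using gD[OF n] norm_ge_zero order_trans by blast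
  have E0: "0 \<le> E k" for k using near[OF n] norm_ge_zero order_trans by blast
  have lip: "f i u - f i v \<le> D * norm (u - v)" if i: "i < n" for i u v
  proof -
    obtain w where w: "w \<in> subgradients (f i) u" using subgradient_exists[OF convex[OF i]] .
    then have "f i u + inner w (v - u) \<le> f i v" by (simp add: subgradients_def)
    moreover have "\<bar>inner w (v - u)\<bar> \<le> norm w * norm (v - u)" by (rule Cauchy_Schwarz_ineq2)
    moreover have "norm w * norm (v - u) \<le> D * norm (v - u)"
      using bound[OF i w] by (rule mult_right_mono) simp
    ultimately show ?thesis by (simp add: norm_minus_commute)
  qed
  have Flip: "F u - F v \<le> n * D * norm (u - v)" for u v
  proof -
    have "F u - F v = (\<Sum>i<n. f i u - f i v)" by (simp add: F sum_subtractf)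
    also have "\<dots> \<le> (\<Sum>i<n. D * norm (u - v))" using lip by (intro sum_mono) simp
    finally show ?thesis by simp
  qed
  have sumg: "norm (\<Sum>i<n. g k i) \<le> n * D" for k
    using sum_norm_le[of "{..<n}" "\<lambda>i. g k i" "\<lambda>_. D"] gD by simp
  define a where "a k = F (zb k) - fstar" for k
  have a0: "0 \<le> a k" for k using minimal by (simp add: a_def)
  have step: "2 / n * (\<alpha> k * a k) \<le>
      (norm (zb k - xs))\<^sup>2 - (norm (zb (Suc k) - xs))\<^sup>2 + (4 * D * (\<alpha> k * E k) + D\<^sup>2 * (\<alpha> k)\<^sup>2)" for k
  proof -
    let ?G = "\<Sum>i<n. g k i"
    \<comment> \<open>One \<open>D * E k\<close> pays for moving \<open>f i\<close> from
      \<open>x k i\<close> to \<open>zb k\<close>, the other for the same move inside the inner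
      product.\<close>
    have each: "inner (g k i) (zb k - xs) \<ge> f i (zb k) - f i xs - 2 * D * E k" if i: "i < n" for i
    proof -
      have "f i (x k i) + inner (g k i) (xs - x k i) \<le> f i xs"
        using g[OF i, of k] by (simp add: subgradients_def)
      moreover have "f i (zb k) - f i (x k i) \<le> D * E k"
        using lip[OF i, of "zb k" "x k i"] mult_left_mono[OF near[OF i, of k] D0]
        by (simp add: norm_minus_commute)
      moreover have "- (D * E k) \<le> inner (g k i) (zb k - x k i)"
      proof -
        have "\<bar>inner (g k i) (zb k - x k i)\<bar> \<le> norm (g k i) * norm (zb k - x k i)"
          by (rule Cauchy_Schwarz_ineq2)
        also have "\<dots> \<le> D * E k" using gD[OF i] near[OF i, of k] D0
          by (intro mult_mono) (auto simp: norm_minus_commute)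
        finally show ?thesis by linarith
      qed
      ultimately show ?thesis by (simp add: inner_diff_right)
    qed
    have "inner ?G (zb k - xs) = (\<Sum>i<n. inner (g k i) (zb k - xs))" by (rule inner_sum_left)
    also have "\<dots> \<ge> (\<Sum>i<n. f i (zb k) - f i xs - 2 * D * E k)" using each by (intro sum_mono) simp
    also have "(\<Sum>i<n. f i (zb k) - f i xs - 2 * D * E k) = a k - n * (2 * D * E k)"
      using xs by (simp add: a_def F sum_subtractf)
    finally have low: "a k - n * (2 * D * E k) \<le> inner ?G (zb k - xs)" .
    let ?s = "\<alpha> k / n"
    have "(norm (zb (Suc k) - xs))\<^sup>2 = (norm (zb k - xs))\<^sup>2 - 2 * ?s * inner ?G (zb k - xs) + ?s\<^sup>2 * (norm ?G)\<^sup>2"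
      unfolding zb power2_norm_eq_inner
      by (simp add: inner_diff inner_commute power2_eq_square algebra_simps)
    also have "?s\<^sup>2 * (norm ?G)\<^sup>2 \<le> ?s\<^sup>2 * (n * D)\<^sup>2"
      using sumg by (intro mult_left_mono power_mono) auto
    also have "?s\<^sup>2 * (n * D)\<^sup>2 = D\<^sup>2 * (\<alpha> k)\<^sup>2" using n by (simp add: power2_eq_square)
    finally have up: "(norm (zb (Suc k) - xs))\<^sup>2 \<le>
      (norm (zb k - xs))\<^sup>2 - 2 * ?s * inner ?G (zb k - xs) + D\<^sup>2 * (\<alpha> k)\<^sup>2" by simp
    have "2 * ?s * (a k - n * (2 * D * E k)) \<le> 2 * ?s * inner ?G (zb k - xs)"
      using low \<alpha>0 by (intro mult_left_mono) auto
    moreover have "2 * ?s * (a k - n * (2 * D * E k)) = 2 / n * (\<alpha> k * a k) - 4 * D * (\<alpha> k * E k)"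
      using n by (simp add: field_simps)
    ultimately show ?thesis using up by linarith
  qed
  have err: "summable (\<lambda>k. 4 * D * (\<alpha> k * E k) + D\<^sup>2 * (\<alpha> k)\<^sup>2)" (is "summable ?e")
    by (intro summable_add summable_mult summable_mult_of_squares sq E)
  have "summable (\<lambda>k. 2 / n * (\<alpha> k * a k))"
  proof (rule bounded_imp_summable)
    fix K
    have "(\<Sum>k\<le>K. 2 / n * (\<alpha> k * a k))
        \<le> (\<Sum>k\<le>K. (norm (zb k - xs))\<^sup>2 - (norm (zb (Suc k) - xs))\<^sup>2 + ?e k)"
      by (intro sum_mono step)
    also have "\<dots> = (norm (zb 0 - xs))\<^sup>2 - (norm (zb (Suc K) - xs))\<^sup>2 + (\<Sum>k\<le>K. ?e k)"
      unfolding sum.distrib using sum_telescope[of "\<lambda>k. (norm (zb k - xs))\<^sup>2" K] by simp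
    also have "\<dots> \<le> (norm (zb 0 - xs))\<^sup>2 + suminf ?e"
    proof -
      have "(\<Sum>k\<le>K. ?e k) \<le> suminf ?e"
        by (rule sum_le_suminf[OF err]) (use \<alpha>0 E0 D0 in auto)
      moreover have "0 \<le> (norm (zb (Suc K) - xs))\<^sup>2" by simp
      ultimately show ?thesis by linarith
    qed
    finally show "(\<Sum>k\<le>K. 2 / n * (\<alpha> k * a k)) \<le> (norm (zb 0 - xs))\<^sup>2 + suminf ?e" .
  qed (use \<alpha>0 a0 in auto)
  from summable_mult[OF this, of "n / 2"] have sm: "summable (\<lambda>k. \<alpha> k * a k)" using n by simp
  have alim: "a \<longlonglongrightarrow> 0"
  proof (rule tendsto_0_of_slow_variation[OF a0 \<alpha>0 summable_square_imp_tendsto_0[OF sq] div sm])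
    fix k
    have "a (Suc k) - a k \<le> n * D * norm (zb (Suc k) - zb k)"
      using Flip[of "zb (Suc k)" "zb k"] by (simp add: a_def)
    also have "\<dots> \<le> n * D * (\<alpha> k * D)"
    proof (intro mult_left_mono)
      have "norm (zb (Suc k) - zb k) = \<alpha> k / n * norm (\<Sum>i<n. g k i)" using \<alpha>0 by (simp add: zb)
      also have "\<dots> \<le> \<alpha> k / n * (n * D)" using sumg \<alpha>0 by (intro mult_left_mono) auto
      also have "\<dots> = \<alpha> k * D" using n by simp
      finally show "norm (zb (Suc k) - zb k) \<le> \<alpha> k * D" .
    qed (use D0 in simp)
    \<comment> \<open>The added 1 keeps the constant positive when \<open>D = 0\<close>.\<close>
    also have "\<dots> \<le> (n * D * D + 1) * \<alpha> k" using \<alpha>0[of k] by (simp add: algebra_simps)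
    finally show "a (Suc k) - a k \<le> (n * D * D + 1) * \<alpha> k" .
  qed (use D0 in \<open>simp add: add_nonneg_pos\<close>)
  have "(\<lambda>k. F (x k i) - fstar) \<longlonglongrightarrow> 0"
  proof (rule tendsto_sandwich[of "\<lambda>_. 0"])
    show "(\<lambda>k. a k + n * D * E k) \<longlonglongrightarrow> 0"
      using tendsto_add[OF alim tendsto_mult_left[OF summable_square_imp_tendsto_0[OF E], of "n * D"]]
      by simp
    show "\<forall>\<^sub>F k in sequentially. F (x k i) - fstar \<le> a k + n * D * E k"
    proof (intro always_eventually allI)
      fix k
      have "F (x k i) - F (zb k) \<le> n * D * norm (x k i - zb k)" by (rule Flip)
      also have "\<dots> \<le> n * D * E k" using near[OF i] D0 by (intro mult_left_mono) auto
      finally show "F (x k i) - fstar \<le> a k + n * D * E k" by (simp add: a_def)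
    qed
  qed (use minimal in auto)
  then show ?thesis by (simp add: LIM_zero_iff)
qed

section \<open>Resolvents of contractions\<close>

text \<open>Induction on the linear factors of an annihilating polynomial. Dividing out a factor
  \<open>T - m\<close> by itself would cost a power of \<open>1 / \<Delta>\<close> each time.
  Composing it with the inverse of \<open>1 - cnj m * T\<close> instead gives an operator of norm at
  most 3, uniformly in \<open>m\<close>, so the constants multiply by 3 while
  \<open>1 / \<Delta>\<close> enters only additively. The last list entry is the factor that
  \<open>foldr\<close> applies first, hence \<open>rev_induct\<close>.\<close>

lemma resolvent_bound:
  fixes T :: "(nat \<Rightarrow> complex) \<Rightarrow> (nat \<Rightarrow> complex)" and N :: "(nat \<Rightarrow> complex) \<Rightarrow> real"
  assumes lin: "\<And>a b x y. T (\<lambda>i. a * x i + b * y i) = (\<lambda>i. a * T x i + b * T y i)"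
    and N0: "\<And>x. 0 \<le> N x"
    and Nlin: "\<And>a b x y. N (\<lambda>i. a * x i + b * y i) \<le> cmod a * N x + cmod b * N y"
    and contr: "\<And>x. N (T x) \<le> N x"
    and surj: "\<And>m x. cmod m < 1 \<Longrightarrow> \<exists>\<xi>. x = (\<lambda>i. \<xi> i - m * T \<xi> i)"
    and \<Delta>: "0 < \<Delta>" and z: "1 \<le> cmod z"
  shows "\<lbrakk>\<forall>m\<in>set es. cmod m \<le> 1 - \<Delta>; N (foldr (\<lambda>m x i. T x i - m * x i) es x) = 0\<rbrakk>
    \<Longrightarrow> N x \<le> (3 ^ length es - 1) / \<Delta> * N (\<lambda>i. z * x i - T x i)"
proof (induction es arbitrary: x rule: rev_induct)
  case Nil
  then show ?case by simp
next
  case (snoc m es)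
  let ?P = "\<lambda>es. foldr (\<lambda>m x i. T x i - m * x i) es"
  have m: "cmod m \<le> 1 - \<Delta>" and m1: "cmod m < 1" using snoc.prems \<Delta> by auto
  have linP: "?P es (\<lambda>i. a * x i + b * y i) = (\<lambda>i. a * ?P es x i + b * ?P es y i)" for a b x y es
  proof (induction es)
    case (Cons e es)
    show ?case by (simp only: foldr.simps comp_apply Cons lin) (simp add: algebra_simps)
  qed simp
  have TP: "T (?P es x) = ?P es (T x)" for es x
  proof (induction es)
    case (Cons e es)
    show ?case using lin[of 1 "T (?P es x)" "- e" "?P es x"] by (simp add: Cons)
  qed simp
  have lin1: "T (\<lambda>i. x i - a * y i) = (\<lambda>i. T x i - a * T y i)" for x y a
    using lin[of 1 x "- a" y] by simp
  have linP1: "?P es (\<lambda>i. x i - a * y i) = (\<lambda>i. ?P es x i - a * ?P es y i)" for x y a es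
    using linP[of es 1 x "- a" y] by simp
  have N1: "N (\<lambda>i. x i - a * y i) \<le> N x + cmod a * N y" for x y a
    using Nlin[of 1 x "- a" y] by simp
  have cm: "cmod (cnj m) = cmod m" by simp
  have inv: "(1 - cmod m) * N \<xi> \<le> N (\<lambda>i. \<xi> i - cnj m * T \<xi> i)" for \<xi>
  proof -
    have "N \<xi> \<le> N (\<lambda>i. \<xi> i - cnj m * T \<xi> i) + cmod m * N (T \<xi>)"
      using Nlin[of 1 "\<lambda>i. \<xi> i - cnj m * T \<xi> i" "cnj m" "T \<xi>"] by simp
    moreover have "cmod m * N (T \<xi>) \<le> cmod m * N \<xi>" using contr by (intro mult_left_mono) auto
    ultimately show ?thesis by (simp add: algebra_simps)
  qed
  \<comment> \<open>With \<open>?u\<close> the image of \<open>\<xi>\<close> under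
    \<open>1 - cnj m * T\<close>, the left side is \<open>- m\<close> times \<open>?u\<close> plus
    \<open>1 - |m|^2\<close> times \<open>T \<xi>\<close>. The factor \<open>1 - |m|\<close>
    contained in \<open>1 - |m|^2\<close> absorbs the large inverse in \<open>inv\<close>; what
    remains is \<open>|m| + (1 + |m|) \<le> 3\<close>.\<close>
  have mobius: "N (\<lambda>i. T \<xi> i - m * \<xi> i) \<le> 3 * N (\<lambda>i. \<xi> i - cnj m * T \<xi> i)" for \<xi>
  proof -
    let ?u = "\<lambda>i. \<xi> i - cnj m * T \<xi> i"
    have q: "(of_real (cmod m))\<^sup>2 = m * cnj m" using complex_norm_square[of m] by simp
    have "(\<lambda>i. T \<xi> i - m * \<xi> i) = (\<lambda>i. (- m) * ?u i + of_real (1 - (cmod m)\<^sup>2) * T \<xi> i)"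
      by (simp add: q algebra_simps)
    then have "N (\<lambda>i. T \<xi> i - m * \<xi> i) \<le> cmod (- m) * N ?u + cmod (of_real (1 - (cmod m)\<^sup>2)) * N (T \<xi>)"
      using Nlin by metis
    also have "cmod (of_real (1 - (cmod m)\<^sup>2)) = (1 + cmod m) * (1 - cmod m)"
    proof -
      have "(cmod m)\<^sup>2 \<le> 1" using m1 by (simp add: abs_square_le_1)
      then show ?thesis unfolding norm_of_real by (simp add: power2_eq_square algebra_simps)
    qed
    also have "(1 + cmod m) * (1 - cmod m) * N (T \<xi>) \<le> (1 + cmod m) * ((1 - cmod m) * N \<xi>)"
      using contr[of \<xi>] m1 by (simp add: mult_left_mono mult.assoc)
    also have "\<dots> \<le> (1 + cmod m) * N ?u" using inv by (intro mult_left_mono) auto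
    also have "cmod (- m) * N ?u + (1 + cmod m) * N ?u = (1 + 2 * cmod m) * N ?u" by (simp add: algebra_simps)
    also have "\<dots> \<le> 3 * N ?u" using m1 N0 by (intro mult_right_mono) auto
    finally show ?thesis by simp
  qed
  \<comment> \<open>\<open>y\<close> is the image of \<open>x\<close> under the Blaschke factor \<open>(T - m) / (1 - cnj m * T)\<close>, whose modulus at \<open>z\<close>
    is at least 1.\<close>
  obtain \<xi> where \<xi>: "x = (\<lambda>i. \<xi> i - cnj m * T \<xi> i)" using surj[of "cnj m" x] m1 by auto
  define y where "y = (\<lambda>i. T \<xi> i - m * \<xi> i)"
  define R where "R = N (\<lambda>i. z * x i - T x i)"
  define \<zeta> where "\<zeta> = (\<lambda>i. T \<xi> i - z * \<xi> i)"
  have Pfull: "?P (es @ [m]) x = ?P es (\<lambda>i. T x i - m * x i)" for x by simp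
  \<comment> \<open>All operators involved commute, so the full product at \<open>x\<close> is
    \<open>1 - cnj m * T\<close> applied to \<open>?P es y\<close>, and by \<open>inv\<close> that
    operator loses no vector of positive \<open>N\<close>.\<close>
  have "N (?P es y) = 0"
  proof -
    have "?P (es @ [m]) x = (\<lambda>i. ?P es y i - cnj m * T (?P es y) i)"
      unfolding TP Pfull linP1[symmetric] y_def \<xi> lin1 by (simp add: algebra_simps)
    with snoc.prems(2) inv[of "?P es y"] have "(1 - cmod m) * N (?P es y) \<le> 0" by simp
    with N0[of "?P es y"] m1 show ?thesis by (simp add: mult_le_0_iff)
  qed
  moreover have "\<forall>m\<in>set es. cmod m \<le> 1 - \<Delta>" using snoc.prems by simp
  ultimately have "N y \<le> (3 ^ length es - 1) / \<Delta> * N (\<lambda>i. z * y i - T y i)" by (rule snoc.IH[rotated])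
  also have "N (\<lambda>i. z * y i - T y i) \<le> 3 * R"
  proof -
    have x\<zeta>: "(\<lambda>i. \<zeta> i - cnj m * T \<zeta> i) = (\<lambda>i. (- 1) * (z * x i - T x i))"
      unfolding \<zeta>_def lin1 \<xi> by (simp add: algebra_simps)
    have y\<zeta>: "(\<lambda>i. z * y i - T y i) = (\<lambda>i. (- 1) * (T \<zeta> i - m * \<zeta> i))"
      unfolding \<zeta>_def lin1 y_def by (simp add: algebra_simps)
    have neg: "N (\<lambda>i. (- 1) * w i) \<le> N w" for w using Nlin[of "- 1" w 0 w] by simp
    have "N (\<lambda>i. z * y i - T y i) \<le> N (\<lambda>i. T \<zeta> i - m * \<zeta> i)" unfolding y\<zeta> by (rule neg)
    also have "\<dots> \<le> 3 * N (\<lambda>i. \<zeta> i - cnj m * T \<zeta> i)" by (rule mobius)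
    also have "\<dots> \<le> 3 * R" unfolding x\<zeta> R_def by (intro mult_left_mono neg) auto
    finally show ?thesis .
  qed
  finally have Ny: "N y \<le> (3 ^ length es - 1) / \<Delta> * (3 * R)"
    using \<Delta> by (meson divide_nonneg_nonneg diff_ge_0_iff_ge less_imp_le mult_left_mono one_le_numeral one_le_power order_trans)
  have R\<zeta>: "(1 - cmod m) * N \<zeta> \<le> R"
  proof -
    have "(\<lambda>i. \<zeta> i - cnj m * T \<zeta> i) = (\<lambda>i. (- 1) * (z * x i - T x i))"
      unfolding \<zeta>_def lin1 \<xi> by (simp add: algebra_simps)
    then show ?thesis
      using inv[of \<zeta>] Nlin[of "- 1" "\<lambda>i. z * x i - T x i" 0 "\<lambda>i. 0"] unfolding R_def by simp
  qed
  have zm: "\<Delta> \<le> cmod (z - m)" using norm_triangle_ineq2[of z m] z m by linarith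
  have "cmod (1 - cnj m * z) \<le> cmod (z - m)"
  proof -
    have "(cmod (z - m))\<^sup>2 - (cmod (1 - cnj m * z))\<^sup>2 = ((cmod z)\<^sup>2 - 1) * (1 - (cmod m)\<^sup>2)"
      unfolding cmod_power2 by (simp add: power2_eq_square algebra_simps)
    also have "\<dots> \<ge> 0" using z m1 by (simp add: abs_square_le_1)
    finally have "(cmod (1 - cnj m * z))\<^sup>2 \<le> (cmod (z - m))\<^sup>2" by linarith
    then show ?thesis by (rule power2_le_imp_le) simp
  qed
  \<comment> \<open>This recovers \<open>x\<close> from its Blaschke image: \<open>z - m\<close>
    times \<open>x\<close> equals \<open>1 - cnj m * z\<close> times \<open>y\<close> minus
    \<open>1 - |m|^2\<close> times \<open>\<zeta>\<close>. Here \<open>\<zeta>\<close> may be as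
    large as \<open>R / (1 - |m|)\<close>, which its coefficient compensates.\<close>
  moreover have "cmod (z - m) * N x \<le> cmod (1 - cnj m * z) * N y + (1 - (cmod m)\<^sup>2) * N \<zeta>"
  proof -
    have q: "(of_real (cmod m))\<^sup>2 = m * cnj m" using complex_norm_square[of m] by simp
    let ?w = "\<lambda>i. (1 - cnj m * z) * y i + (- of_real (1 - (cmod m)\<^sup>2)) * \<zeta> i"
    have "(z - m) * x i = ?w i" for i
      unfolding \<xi> y_def \<zeta>_def by (simp add: q algebra_simps)
    moreover have nz: "z - m \<noteq> 0" using zm \<Delta> by auto
    ultimately have "x = (\<lambda>i. inverse (z - m) * ?w i + 0 * y i)"
      by (metis (no_types, lifting) add.right_neutral left_inverse mult.assoc mult_1 mult_zero_left ext)
    with Nlin[of "inverse (z - m)" ?w 0 y] have "N x \<le> inverse (cmod (z - m)) * N ?w"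
      by (simp only: norm_inverse norm_zero mult_zero_left add_0_right)
    then have "cmod (z - m) * N x \<le> cmod (z - m) * (inverse (cmod (z - m)) * N ?w)"
      by (rule mult_left_mono) simp
    also have "\<dots> = N ?w" using nz by (simp only: mult.assoc[symmetric]) simp
    also have "\<dots> \<le> cmod (1 - cnj m * z) * N y + cmod (- of_real (1 - (cmod m)\<^sup>2)) * N \<zeta>" by (rule Nlin)
    also have "cmod (- of_real (1 - (cmod m)\<^sup>2)) = 1 - (cmod m)\<^sup>2"
      using m1 unfolding norm_minus_cancel norm_of_real by (simp add: abs_square_le_1)
    finally show ?thesis .
  qed
  moreover have "(1 - (cmod m)\<^sup>2) * N \<zeta> \<le> 2 * R"
  proof -
    have "(1 - (cmod m)\<^sup>2) * N \<zeta> = (1 + cmod m) * ((1 - cmod m) * N \<zeta>)"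
      by (simp add: power2_eq_square algebra_simps)
    also have "\<dots> \<le> (1 + cmod m) * R" using R\<zeta> by (intro mult_left_mono) auto
    also have "\<dots> \<le> 2 * R" using m1 N0 by (intro mult_right_mono) (auto simp: R_def)
    finally show ?thesis .
  qed
  ultimately have "cmod (z - m) * N x \<le> cmod (z - m) * N y + 2 * R"
    using mult_right_mono[of "cmod (1 - cnj m * z)" "cmod (z - m)" "N y"] N0[of y] by linarith
  then have le: "cmod (z - m) * (N x - N y) \<le> 2 * R" by (simp add: algebra_simps)
  have "\<Delta> * (N x - N y) \<le> 2 * R"
  proof (cases "N x - N y \<ge> 0")
    case True
    with zm have "\<Delta> * (N x - N y) \<le> cmod (z - m) * (N x - N y)" by (rule mult_right_mono)
    with le show ?thesis by linarith
  next
    case False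
    then have "\<Delta> * (N x - N y) \<le> 0" using \<Delta> by (simp add: mult_le_0_iff)
    moreover have "0 \<le> R" using N0 by (simp add: R_def)
    ultimately show ?thesis by linarith
  qed
  then have "N x - N y \<le> 2 * R / \<Delta>" using \<Delta> by (simp add: pos_le_divide_eq mult.commute)
  with Ny have "N x \<le> 2 * R / \<Delta> + (3 ^ length es - 1) / \<Delta> * (3 * R)" by linarith
  \<comment> \<open>The constants obey \<open>c' = 3 * c + 2 / \<Delta>\<close> with initial value
    0, whose solution is \<open>(3 ^ l - 1) / \<Delta>\<close>.\<close>
  also have "\<dots> = (3 ^ length (es @ [m]) - 1) / \<Delta> * R" using \<Delta> by (simp add: field_simps)
  finally show ?case by (simp add: R_def)
qed

section \<open>Matrices as operators on functions, and annihilation by linear factors\<close>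

definition mat_app :: "nat \<Rightarrow> complex mat \<Rightarrow> (nat \<Rightarrow> complex) \<Rightarrow> nat \<Rightarrow> complex" where
  "mat_app n C x = (\<lambda>i. if i < n then (\<Sum>j<n. C $$ (i, j) * x j) else 0)"

text \<open>An equality of functions on all of \<open>nat\<close>, as \<open>resolvent_bound\<close>
  demands; the value 0 of \<open>mat_app\<close> off the index range makes it hold there
  too.\<close>

lemma mat_app_lin: "mat_app n C (\<lambda>i. a * x i + b * y i) = (\<lambda>i. a * mat_app n C x i + b * mat_app n C y i)"
  by (rule ext) (simp add: mat_app_def sum.distrib sum_distrib_left algebra_simps)

lemma vec_mat_app: "C \<in> carrier_mat n n \<Longrightarrow> vec n (mat_app n C x) = C *\<^sub>v vec n x"
  by (rule eq_vecI) (auto simp: mat_app_def scalar_prod_def atLeast0LessThan intro!: sum.cong)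

text \<open>Each factor, taken from the last diagonal entry backwards, shortens by one the initial
  segment of indices that supports the vector.\<close>

lemma upper_triangular_annihilates:
  fixes B :: "complex mat"
  assumes B: "B \<in> carrier_mat n n" "upper_triangular B"
  shows "\<lbrakk>k \<le> n; v \<in> carrier_vec n; \<forall>i<n. k \<le> i \<longrightarrow> v $ i = 0\<rbrakk> \<Longrightarrow>
    foldr (\<lambda>e v. B *\<^sub>v v - e \<cdot>\<^sub>v v) (take k (diag_mat B)) v = 0\<^sub>v n"
proof (induction k arbitrary: v)
  case 0
  then show ?case by (auto intro!: eq_vecI)
next
  case (Suc k)
  then have k: "k < length (diag_mat B)" using B by (simp add: diag_mat_def)
  let ?w = "B *\<^sub>v v - (diag_mat B ! k) \<cdot>\<^sub>v v"
  have e: "diag_mat B ! k = B $$ (k, k)" using k B by (simp add: diag_mat_def)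
  have "?w $ i = 0" if i: "i < n" "k \<le> i" for i
  proof -
    have "(B *\<^sub>v v) $ i = (\<Sum>j<n. B $$ (i, j) * v $ j)"
      using B(1) Suc.prems(2) i by (auto simp: scalar_prod_def atLeast0LessThan)
    also have "\<dots> = (\<Sum>j<n. if j = k then B $$ (i, k) * v $ k else 0)"
    proof (rule sum.cong)
      fix j assume "j \<in> {..<n}"
      then show "B $$ (i, j) * v $ j = (if j = k then B $$ (i, k) * v $ k else 0)"
        using B Suc.prems(3) i by (cases "j < k") auto
    qed simp
    also have "\<dots> = B $$ (i, k) * v $ k" using Suc.prems(1) by simp
    also have "\<dots> = B $$ (k, k) * v $ i"
      using B Suc.prems i by (cases "i = k") auto
    finally show ?thesis using i B Suc.prems(2) by (simp add: e)
  qed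
  moreover have "?w \<in> carrier_vec n" using B Suc.prems(2) by auto
  ultimately show ?case using Suc.IH[of ?w] Suc.prems(1) k by (simp add: take_Suc_conv_app_nth)
qed

text \<open>Schur decomposition with the prescribed eigenvalue list reduces this to the triangular
  case; the base change \<open>P\<close> intertwines the two products of factors.\<close>

lemma cayley_hamilton_linear_factors:
  fixes C :: "complex mat"
  assumes C: "C \<in> carrier_mat n n" and es: "char_poly C = (\<Prod>e\<leftarrow>es. [:- e, 1:])"
    and i: "i < n"
  shows "foldr (\<lambda>e x i. mat_app n C x i - e * x i) es x i = 0"
proof -
  obtain B P Q where "schur_decomposition C es = (B, P, Q)" by (metis prod_cases3)
  from schur_decomposition[OF C es this]
  have sim: "similar_mat_wit C B P Q" and up: "upper_triangular B" and d: "diag_mat B = es" by auto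
  from sim C have car: "B \<in> carrier_mat n n" "P \<in> carrier_mat n n" "Q \<in> carrier_mat n n"
    and PQ: "P * Q = 1\<^sub>m n" and QP: "Q * P = 1\<^sub>m n" and CPBQ: "C = P * B * Q"
    by (auto simp: similar_mat_wit_def Let_def)
  have CP: "C * P = P * B"
  proof -
    have "C * P = P * B * (Q * P)"
      unfolding CPBQ using car by (intro assoc_mult_mat[of _ n n _ n _ n]) auto
    then show ?thesis using QP car by simp
  qed
  have inter: "foldr (\<lambda>e v. C *\<^sub>v v - e \<cdot>\<^sub>v v) es (P *\<^sub>v v)
        = P *\<^sub>v foldr (\<lambda>e v. B *\<^sub>v v - e \<cdot>\<^sub>v v) es v \<and>
      foldr (\<lambda>e v. B *\<^sub>v v - e \<cdot>\<^sub>v v) es v \<in> carrier_vec n"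
    if v: "v \<in> carrier_vec n" for v es
  proof (induction es)
    case (Cons e es)
    let ?f = "foldr (\<lambda>e v. B *\<^sub>v v - e \<cdot>\<^sub>v v) es v"
    have f: "?f \<in> carrier_vec n" using Cons by simp
    have "C *\<^sub>v (P *\<^sub>v ?f) = P *\<^sub>v (B *\<^sub>v ?f)"
      using assoc_mult_mat_vec[OF C car(2) f] assoc_mult_mat_vec[OF car(2,1) f] CP by simp
    moreover have "P *\<^sub>v (B *\<^sub>v ?f - e \<cdot>\<^sub>v ?f) = P *\<^sub>v (B *\<^sub>v ?f) - e \<cdot>\<^sub>v (P *\<^sub>v ?f)"
      using mult_minus_distrib_mat_vec[OF car(2), of "B *\<^sub>v ?f" "e \<cdot>\<^sub>v ?f"] mult_mat_vec[OF car(2) f] car f by simp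
    ultimately show ?case using Cons f car by auto
  qed (use v in simp)
  have link: "vec n (foldr (\<lambda>e x i. mat_app n C x i - e * x i) es x)
      = foldr (\<lambda>e v. C *\<^sub>v v - e \<cdot>\<^sub>v v) es (vec n x)" for es
  proof (induction es)
    case (Cons e es)
    let ?f = "foldr (\<lambda>e x i. mat_app n C x i - e * x i) es x"
    have "vec n (\<lambda>i. mat_app n C ?f i - e * ?f i) = vec n (mat_app n C ?f) - e \<cdot>\<^sub>v vec n ?f"
      by (rule eq_vecI) auto
    then show ?case using Cons by (simp add: vec_mat_app[OF C])
  qed simp
  have "vec n x = P *\<^sub>v (Q *\<^sub>v vec n x)"
    using assoc_mult_mat_vec[OF car(2,3) vec_carrier, of x] PQ by simp
  moreover have "foldr (\<lambda>e v. B *\<^sub>v v - e \<cdot>\<^sub>v v) es (Q *\<^sub>v vec n x) = 0\<^sub>v n"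
  proof -
    have "length es = n" using d car(1) by (auto simp: diag_mat_def)
    then show ?thesis
      using upper_triangular_annihilates[OF car(1) up, of n "Q *\<^sub>v vec n x"] car(3) d by simp
  qed
  ultimately have "vec n (foldr (\<lambda>e x i. mat_app n C x i - e * x i) es x) = P *\<^sub>v 0\<^sub>v n"
    using link[of es] inter[of "Q *\<^sub>v vec n x" es] car(3) by simp
  also have "\<dots> = 0\<^sub>v n" using car(2) by (intro eq_vecI) auto
  finally have "vec n (foldr (\<lambda>e x i. mat_app n C x i - e * x i) es x) $ i = (0\<^sub>v n :: complex vec) $ i" by simp
  then show ?thesis using i by simp
qed

lemma surj_id_minus_smult:
  fixes C :: "complex mat"
  assumes C: "C \<in> carrier_mat n n"
    and inj: "\<And>x i. \<lbrakk>\<And>i. i < n \<Longrightarrow> x i = m * mat_app n C x i; i < n\<rbrakk> \<Longrightarrow> x i = 0"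
  shows "\<exists>\<xi>. x = (\<lambda>i. \<xi> i - m * mat_app n C \<xi> i)"
proof -
  let ?K = "1\<^sub>m n - m \<cdot>\<^sub>m C"
  have K: "?K \<in> carrier_mat n n" using C by (auto simp: minus_mat_def)
  have Kv: "?K *\<^sub>v v = v - m \<cdot>\<^sub>v (C *\<^sub>v v)" if "v \<in> carrier_vec n" for v
  proof -
    have "?K *\<^sub>v v = 1\<^sub>m n *\<^sub>v v - (m \<cdot>\<^sub>m C) *\<^sub>v v"
      using C that by (intro minus_mult_distrib_mat_vec) auto
    also have "(m \<cdot>\<^sub>m C) *\<^sub>v v = m \<cdot>\<^sub>v (C *\<^sub>v v)"
      using C that by (intro eq_vecI) (auto simp: scalar_prod_def sum_distrib_left mult.assoc)
    finally show ?thesis using that by simp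
  qed
  have "det ?K \<noteq> 0"
  proof
    assume "det ?K = 0"
    then obtain v where v: "v \<in> carrier_vec n" "v \<noteq> 0\<^sub>v n" "?K *\<^sub>v v = 0\<^sub>v n"
      using det_0_iff_vec_prod_zero_field[OF K] by blast
    have "v $ i = m * mat_app n C (\<lambda>i. v $ i) i" if "i < n" for i
    proof -
      have "(v - m \<cdot>\<^sub>v (C *\<^sub>v v)) $ i = 0" using v(3) Kv[OF v(1)] that by simp
      moreover have "(C *\<^sub>v v) $ i = mat_app n C (\<lambda>i. v $ i) i"
        using C v(1) that by (auto simp: mat_app_def scalar_prod_def atLeast0LessThan)
      ultimately show ?thesis using C v(1) that by simp
    qed
    then have "v $ i = 0" if "i < n" for i using that by (rule inj[of "\<lambda>i. v $ i"])
    then have "v = 0\<^sub>v n" using v(1) by (intro eq_vecI) auto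
    with v(2) show False by simp
  qed
  then obtain L where L: "L \<in> carrier_mat n n" "?K * L = 1\<^sub>m n"
    using det_non_zero_imp_unit[OF K, of "()"] by (auto simp: Units_def ring_mat_def)
  \<comment> \<open>Off the index range \<open>mat_app\<close> returns 0, so \<open>\<xi>\<close>
    has to agree with \<open>x\<close> there.\<close>
  define \<xi> where "\<xi> i = (if i < n then (L *\<^sub>v vec n x) $ i else x i)" for i
  have vx: "vec n \<xi> = L *\<^sub>v vec n x" using L(1) by (intro eq_vecI) (auto simp: \<xi>_def)
  have "x i = \<xi> i - m * mat_app n C \<xi> i" for i
  proof (cases "i < n")
    case True
    have "vec n x = ?K *\<^sub>v vec n \<xi>"
      unfolding vx using assoc_mult_mat_vec[OF K L(1) vec_carrier, of x] L(2) by simp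
    also have "\<dots> = vec n \<xi> - m \<cdot>\<^sub>v vec n (mat_app n C \<xi>)" by (simp add: Kv vec_mat_app[OF C])
    finally have "vec n x $ i = (vec n \<xi> - m \<cdot>\<^sub>v vec n (mat_app n C \<xi>)) $ i" by simp
    with True show ?thesis by simp
  qed (simp add: \<xi>_def mat_app_def)
  then show ?thesis by blast
qed

section \<open>Irreducible stochastic matrices\<close>

text \<open>Irreducibility is phrased by closed sets instead of paths, because it is applied to the
  support of an invariant vector and to a level set of a harmonic one.\<close>

definition irreducible_weights :: "nat \<Rightarrow> (nat \<Rightarrow> nat \<Rightarrow> real) \<Rightarrow> bool" where
  "irreducible_weights n a \<longleftrightarrow>
    (\<forall>S \<subseteq> {..<n}. S \<noteq> {} \<longrightarrow> (\<forall>i\<in>S. \<forall>j<n. a i j > 0 \<longrightarrow> j \<in> S) \<longrightarrow> S = {..<n})"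

lemma irreducible_weightsD:
  assumes "irreducible_weights n a" "S \<subseteq> {..<n}" "S \<noteq> {}"
    and "\<And>i j. \<lbrakk>i \<in> S; j < n; a i j > 0\<rbrakk> \<Longrightarrow> j \<in> S"
  shows "S = {..<n}"
  using assms(1)[unfolded irreducible_weights_def, rule_format, OF assms(2,3)] assms(4) by blast

text \<open>The constant vector makes \<open>a - I\<close> singular, so its transpose has a kernel
  vector \<open>v\<close>, that is, a left fixed vector. Its absolute values satisfy
  \<open>w \<le> w a\<close> entrywise; both sides have the same total because the rows sum to 1, so
  equality holds. The support of \<open>w\<close> is closed, hence everything.\<close>

lemma stationary_distribution_exists:
  assumes n: "n > 0" and nonneg: "\<And>i j. \<lbrakk>i < n; j < n\<rbrakk> \<Longrightarrow> 0 \<le> a i j"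
    and row: "\<And>i. i < n \<Longrightarrow> (\<Sum>j<n. a i j) = 1" and irr: "irreducible_weights n a"
  obtains p where "\<And>i. i < n \<Longrightarrow> p i > 0" "(\<Sum>i<n. p i) = 1"
    "\<And>j. j < n \<Longrightarrow> (\<Sum>i<n. p i * a i j) = p j"
proof -
  define K where "K = mat n n (\<lambda>(i, j). a i j - (if i = j then 1 else 0))"
  have K: "K \<in> carrier_mat n n" by (simp add: K_def)
  have sumK: "(\<Sum>j<n. a i j * v j - (if i = j then v j else 0)) = (\<Sum>j<n. a i j * v j) - v i"
    if "i < n" for i and v :: "nat \<Rightarrow> real" and a
    using that by (simp add: sum_subtractf)
  have "K *\<^sub>v vec n (\<lambda>_. 1) = 0\<^sub>v n"
  proof (rule eq_vecI)
    fix i assume "i < dim_vec (0\<^sub>v n :: real vec)"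
    then show "(K *\<^sub>v vec n (\<lambda>_. 1)) $ i = 0\<^sub>v n $ i"
      using sumK[of i a "\<lambda>_. 1"] row by (simp add: K_def scalar_prod_def atLeast0LessThan)
  qed (simp add: K_def)
  moreover have "vec n (\<lambda>_. 1 :: real) \<noteq> 0\<^sub>v n"
  proof
    assume "vec n (\<lambda>_. 1 :: real) = 0\<^sub>v n"
    then have "vec n (\<lambda>_. 1 :: real) $ 0 = 0\<^sub>v n $ 0" by simp
    with n show False by simp
  qed
  ultimately have "det K = 0" using det_0_iff_vec_prod_zero_field[OF K] vec_carrier by blast
  then have "det (transpose_mat K) = 0" using det_transpose[OF K] by simp
  then obtain v where v: "v \<in> carrier_vec n" "v \<noteq> 0\<^sub>v n" "transpose_mat K *\<^sub>v v = 0\<^sub>v n"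
    using det_0_iff_vec_prod_zero_field[of "transpose_mat K" n] K by auto
  have fix_v: "(\<Sum>i<n. v $ i * a i j) = v $ j" if j: "j < n" for j
  proof -
    have "0 = (transpose_mat K *\<^sub>v v) $ j" using v(3) j by simp
    also have "\<dots> = (\<Sum>i<n. a i j * v $ i - (if j = i then v $ i else 0))"
      using K v(1) j by (auto simp: K_def scalar_prod_def atLeast0LessThan left_diff_distrib intro!: sum.cong)
    also have "\<dots> = (\<Sum>i<n. a i j * v $ i) - v $ j" using sumK[OF j, of "\<lambda>j i. a i j"] .
    finally show ?thesis by (simp add: mult.commute)
  qed
  define w where "w i = \<bar>v $ i\<bar>" for i
  have le: "w j \<le> (\<Sum>i<n. w i * a i j)" if j: "j < n" for j
  proof -
    have "w j = \<bar>\<Sum>i<n. v $ i * a i j\<bar>" using fix_v[OF j] by (simp add: w_def)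
    also have "\<dots> \<le> (\<Sum>i<n. \<bar>v $ i * a i j\<bar>)" by (rule sum_abs)
    also have "\<dots> = (\<Sum>i<n. w i * a i j)" using nonneg j by (simp add: w_def abs_mult)
    finally show ?thesis .
  qed
  have "(\<Sum>j<n. (\<Sum>i<n. w i * a i j) - w j) = (\<Sum>i<n. \<Sum>j<n. w i * a i j) - (\<Sum>j<n. w j)"
    unfolding sum_subtractf by (subst sum.swap) simp
  also have "\<dots> = 0" using row by (simp add: sum_distrib_left[symmetric])
  finally have "(\<Sum>j<n. (\<Sum>i<n. w i * a i j) - w j) = 0" .
  moreover have "\<forall>j\<in>{..<n}. 0 \<le> (\<Sum>i<n. w i * a i j) - w j" using le by simp
  ultimately have fix_w: "(\<Sum>i<n. w i * a i j) = w j" if "j < n" for j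
    using sum_nonneg_eq_0_iff[of "{..<n}" "\<lambda>j. (\<Sum>i<n. w i * a i j) - w j"] that by simp
  define S where "S = {i. i < n \<and> w i > 0}"
  have "S = {..<n}"
  proof -
    have "\<exists>i<n. v $ i \<noteq> 0"
    proof (rule ccontr)
      assume "\<not> ?thesis"
      then have "v = 0\<^sub>v n" using v(1) by (intro eq_vecI) auto
      with v(2) show False by simp
    qed
    then have "S \<noteq> {}" by (auto simp: S_def w_def)
    moreover have "j \<in> S" if "i \<in> S" "j < n" "a i j > 0" for i j
    proof -
      have "0 < w i * a i j" using that by (simp add: S_def)
      also have "\<dots> \<le> (\<Sum>i<n. w i * a i j)"
        using that nonneg by (intro member_le_sum) (auto simp: S_def w_def)
      finally show ?thesis using fix_w that by (simp add: S_def)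
    qed
    moreover have "S \<subseteq> {..<n}" by (auto simp: S_def)
    ultimately show ?thesis by (intro irreducible_weightsD[OF irr])
  qed
  then have pos: "w i > 0" if "i < n" for i using that by (auto simp: S_def)
  define s where "s = (\<Sum>i<n. w i)"
  have "s > 0" unfolding s_def using pos n by (intro sum_pos) auto
  show thesis
  proof (rule that[of "\<lambda>i. w i / s"])
    show "(\<Sum>i<n. w i / s) = 1" using \<open>s > 0\<close> by (simp add: sum_divide_distrib[symmetric] s_def)
    show "(\<Sum>i<n. w i / s * a i j) = w j / s" if "j < n" for j
      using fix_w[OF that] by (simp add: sum_divide_distrib[symmetric])
  qed (use pos \<open>s > 0\<close> in auto)
qed

text \<open>The \<open>p\<close>-weighted Dirichlet form of a harmonic vector vanishes.\<close>

lemma irreducible_fixed_vector_zero: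
  fixes x :: "nat \<Rightarrow> complex"
  assumes n: "n > 0" and nonneg: "\<And>i j. \<lbrakk>i < n; j < n\<rbrakk> \<Longrightarrow> 0 \<le> a i j"
    and row: "\<And>i. i < n \<Longrightarrow> (\<Sum>j<n. a i j) = 1" and irr: "irreducible_weights n a"
    and p: "\<And>i. i < n \<Longrightarrow> p i > 0" "(\<Sum>i<n. p i) = 1"
      "\<And>j. j < n \<Longrightarrow> (\<Sum>i<n. p i * a i j) = p j"
    and fix_x: "\<And>i. i < n \<Longrightarrow> (\<Sum>j<n. of_real (a i j) * x j) = x i"
    and px: "(\<Sum>i<n. of_real (p i) * x i) = 0" and i: "i < n"
  shows "x i = 0"
proof -
  let ?t = "\<lambda>i j. p i * a i j * (cmod (x j - x i))\<^sup>2"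
  have "(cmod (x j - x i))\<^sup>2 = (cmod (x j))\<^sup>2 + (cmod (x i))\<^sup>2 - 2 * Re (cnj (x i) * x j)" for i j
    unfolding cmod_power2 by (simp add: power2_eq_square algebra_simps)
  \<comment> \<open>Once the squares are expanded, row sums and stationarity turn each of the first
    two sums into the \<open>p\<close>-weighted square norm of \<open>x\<close>. The fixed vector
    equation does the same for the mixed sum, so the three cancel.\<close>
  then have "(\<Sum>i<n. \<Sum>j<n. ?t i j) = (\<Sum>i<n. \<Sum>j<n. p i * a i j * (cmod (x j))\<^sup>2)
      + (\<Sum>i<n. \<Sum>j<n. p i * a i j * (cmod (x i))\<^sup>2)
      - 2 * (\<Sum>i<n. \<Sum>j<n. p i * a i j * Re (cnj (x i) * x j))"
    by (simp only: sum.distrib[symmetric] sum_subtractf[symmetric] sum_distrib_left)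
      (intro sum.cong refl, simp add: algebra_simps)
  also have "(\<Sum>i<n. \<Sum>j<n. p i * a i j * (cmod (x j))\<^sup>2) = (\<Sum>j<n. p j * (cmod (x j))\<^sup>2)"
    by (subst sum.swap) (simp add: sum_distrib_right[symmetric] p(3))
  also have "(\<Sum>i<n. \<Sum>j<n. p i * a i j * (cmod (x i))\<^sup>2) = (\<Sum>j<n. p j * (cmod (x j))\<^sup>2)"
    by (simp add: sum_distrib_right[symmetric] sum_distrib_left[symmetric] row)
  also have "(\<Sum>i<n. \<Sum>j<n. p i * a i j * Re (cnj (x i) * x j)) = (\<Sum>i<n. p i * (cmod (x i))\<^sup>2)"
  proof (rule sum.cong)
    fix i assume "i \<in> {..<n}"
    then have "i < n" by simp
    have "(\<Sum>j<n. p i * a i j * Re (cnj (x i) * x j)) = (\<Sum>j<n. p i * Re (cnj (x i) * (of_real (a i j) * x j)))"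
      by (intro sum.cong) (auto simp: algebra_simps)
    also have "\<dots> = p i * Re (cnj (x i) * (\<Sum>j<n. of_real (a i j) * x j))"
      by (simp only: Re_sum sum_distrib_left)
    also have "\<dots> = p i * (cmod (x i))\<^sup>2"
      unfolding fix_x[OF \<open>i < n\<close>] cmod_power2 by (simp add: power2_eq_square)
    finally show "(\<Sum>j<n. p i * a i j * Re (cnj (x i) * x j)) = p i * (cmod (x i))\<^sup>2" .
  qed simp
  finally have total: "(\<Sum>i<n. \<Sum>j<n. ?t i j) = 0" by simp
  have t0: "0 \<le> ?t i j" if "i < n" "j < n" for i j
    using that p(1)[of i] nonneg[of i j] by simp
  have t: "?t i j = 0" if "i < n" "j < n" for i j
  proof -
    have "(\<Sum>j<n. ?t i j) = 0"
    proof -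
      have "\<forall>i\<in>{..<n}. (\<Sum>j<n. ?t i j) = 0"
        using total by (subst sum_nonneg_eq_0_iff[symmetric]) (use t0 in \<open>auto intro!: sum_nonneg\<close>)
      with that show ?thesis by blast
    qed
    then have "\<forall>j\<in>{..<n}. ?t i j = 0"
      by (subst sum_nonneg_eq_0_iff[symmetric]) (use that t0 in auto)
    with that show ?thesis by blast
  qed
  \<comment> \<open>Vanishing of every term means that \<open>x\<close> does not change along a
    positive weight, so a level set is closed.\<close>
  let ?S = "{i. i < n \<and> x i = x 0}"
  have "j \<in> ?S" if "i \<in> ?S" "j < n" "a i j > 0" for i j
    using t[of i j] that p(1)[of i] by auto
  moreover have "?S \<noteq> {}" using n by blast
  moreover have "?S \<subseteq> {..<n}" by blast
  ultimately have "?S = {..<n}" by (intro irreducible_weightsD[OF irr])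
  then have const: "x i = x 0" if "i < n" for i using that by blast
  have "(\<Sum>i<n. of_real (p i) * x i) = (\<Sum>i<n. of_real (p i) * x 0)"
  proof (rule sum.cong)
    fix i assume "i \<in> {..<n}"
    then have "x i = x 0" by (intro const) simp
    then show "of_real (p i) * x i = of_real (p i) * x 0" by (rule arg_cong)
  qed simp
  also have "\<dots> = of_real (\<Sum>i<n. p i) * x 0" by (simp add: sum_distrib_right)
  finally show ?thesis using px p(2) const[OF i] by simp
qed

text \<open>By the annihilation result, the product of the factors other than \<open>C - 1\<close>
  sends \<open>x\<close> to a fixed vector of \<open>C\<close>. It stays in the kernel of the
  invariant functional \<open>l\<close>, so it vanishes by simplicity. Thus the eigenvalue 1 itself
  never enters the bound, and \<open>n - 1\<close> factors remain.\<close>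

lemma resolvent_bound_on_kernel:
  fixes C :: "complex mat" and N :: "(nat \<Rightarrow> complex) \<Rightarrow> real" and l :: "nat \<Rightarrow> complex"
  assumes C: "C \<in> carrier_mat n n" and n: "n > 0"
    and N0: "\<And>x. 0 \<le> N x"
    and Nlin: "\<And>a b x y. N (\<lambda>i. a * x i + b * y i) \<le> cmod a * N x + cmod b * N y"
    and contr: "\<And>x. N (mat_app n C x) \<le> N x"
    and definite: "\<And>x i. i < n \<Longrightarrow> cmod (x i) \<le> N x"
    and local_N: "\<And>x. (\<And>i. i < n \<Longrightarrow> x i = 0) \<Longrightarrow> N x = 0"
    and l: "\<And>x. (\<Sum>i<n. l i * mat_app n C x i) = (\<Sum>i<n. l i * x i)"
    and simple: "\<And>x i. \<lbrakk>\<And>i. i < n \<Longrightarrow> mat_app n C x i = x i; (\<Sum>i<n. l i * x i) = 0; i < n\<rbrakk> \<Longrightarrow> x i = 0"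
    and es: "char_poly C = (\<Prod>e\<leftarrow>1 # es. [:- e, 1:])" "\<forall>e\<in>set es. cmod e \<le> 1 - \<Delta>"
    and \<Delta>: "0 < \<Delta>" and z: "1 \<le> cmod z" and x: "(\<Sum>i<n. l i * x i) = 0"
  shows "N x \<le> (3 ^ (n - 1) - 1) / \<Delta> * N (\<lambda>i. z * x i - mat_app n C x i)"
proof -
  let ?P = "\<lambda>es. foldr (\<lambda>m x i. mat_app n C x i - m * x i) es"
  have lP: "(\<Sum>i<n. l i * ?P es x i) = 0" for es
  proof (induction es)
    case (Cons e es)
    have "(\<Sum>i<n. l i * ?P (e # es) x i)
        = (\<Sum>i<n. l i * mat_app n C (?P es x) i) - e * (\<Sum>i<n. l i * ?P es x i)"
      by (simp add: sum_subtractf sum_distrib_left algebra_simps)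
    with Cons show ?case by (simp only: l) simp
  qed (use x in simp)
  have "?P es x i = 0" if "i < n" for i
  proof (rule simple[OF _ lP that])
    fix i assume "i < n"
    from cayley_hamilton_linear_factors[OF C es(1) this, of x] show "mat_app n C (?P es x) i = ?P es x i" by simp
  qed
  then have P0: "N (?P es x) = 0" by (rule local_N)
  have len: "length es = n - 1"
  proof -
    have "degree (\<Prod>e\<leftarrow>es. [:- e, 1 :: complex:]) = length es" for es
    proof (induction es)
      case (Cons e es)
      have "(\<Prod>e\<leftarrow>es. [:- e, 1 :: complex:]) \<noteq> 0" by (auto simp: prod_list_zero_iff)
      with Cons show ?case by (simp add: degree_mult_eq del: mult_pCons_left)
    qed simp
    from this[of "1 # es"] have "n = Suc (length es)"
      using degree_monic_char_poly[OF C] unfolding es(1) by simp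
    then show ?thesis by simp
  qed
  have surj: "\<exists>\<xi>. x = (\<lambda>i. \<xi> i - m * mat_app n C \<xi> i)" if m: "cmod m < 1" for m x
  proof (rule surj_id_minus_smult[OF C])
    fix x i assume eq: "\<And>i. i < n \<Longrightarrow> x i = m * mat_app n C x i" and i: "i < n"
    have "N (\<lambda>i. 1 * x i + (- m) * mat_app n C x i) = 0" using eq by (intro local_N) simp
    moreover have "N x \<le> N (\<lambda>i. 1 * x i + (- m) * mat_app n C x i) + cmod m * N (mat_app n C x)"
      using Nlin[of 1 "\<lambda>i. 1 * x i + (- m) * mat_app n C x i" m "mat_app n C x"] by simp
    moreover have "cmod m * N (mat_app n C x) \<le> cmod m * N x" using contr by (intro mult_left_mono) auto
    ultimately have "(1 - cmod m) * N x \<le> 0" by (simp add: algebra_simps)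
    then have "N x \<le> 0" using m by (simp add: mult_le_0_iff)
    with definite[OF i, of x] have "cmod (x i) \<le> 0" by (rule order_trans)
    then show "x i = 0" by simp
  qed
  show ?thesis
    using resolvent_bound[where T = "mat_app n C" and N = N, OF mat_app_lin N0 Nlin contr surj \<Delta> z es(2) P0]
    by (simp add: len)
qed

section \<open>Eigenvalues outside the unit disc\<close>

text \<open>The inserted 0 gives \<open>Max\<close> a nonempty set when
  \<open>n = 0\<close>.\<close>

definition sup_norm :: "nat \<Rightarrow> (nat \<Rightarrow> complex) \<Rightarrow> real" where
  "sup_norm n x = Max (insert 0 ((\<lambda>i. cmod (x i)) ` {..<n}))"

definition sum_norm :: "nat \<Rightarrow> (nat \<Rightarrow> complex) \<Rightarrow> real" where
  "sum_norm n x = (\<Sum>i<n. cmod (x i))"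

lemma sup_norm_nonneg: "0 \<le> sup_norm n x"
  by (simp add: sup_norm_def)

lemma sup_norm_ge: "i < n \<Longrightarrow> cmod (x i) \<le> sup_norm n x"
  by (auto simp: sup_norm_def intro!: Max_ge)

lemma sup_norm_le: "\<lbrakk>0 \<le> b; \<And>i. i < n \<Longrightarrow> cmod (x i) \<le> b\<rbrakk> \<Longrightarrow> sup_norm n x \<le> b"
  by (auto simp: sup_norm_def)

lemma sup_norm_lin: "sup_norm n (\<lambda>i. a * x i + b * y i) \<le> cmod a * sup_norm n x + cmod b * sup_norm n y"
proof (rule sup_norm_le)
  fix i assume "i < n"
  have "cmod (a * x i + b * y i) \<le> cmod a * cmod (x i) + cmod b * cmod (y i)"
    by (metis norm_mult norm_triangle_ineq)
  also have "\<dots> \<le> cmod a * sup_norm n x + cmod b * sup_norm n y"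
    using \<open>i < n\<close> by (intro add_mono mult_left_mono sup_norm_ge) auto
  finally show "cmod (a * x i + b * y i) \<le> cmod a * sup_norm n x + cmod b * sup_norm n y" .
qed (simp add: sup_norm_nonneg)

lemma sum_norm_nonneg: "0 \<le> sum_norm n x"
  by (simp add: sum_norm_def sum_nonneg)

lemma sum_norm_ge: "i < n \<Longrightarrow> cmod (x i) \<le> sum_norm n x"
  unfolding sum_norm_def by (rule member_le_sum) auto

lemma sum_norm_lin: "sum_norm n (\<lambda>i. a * x i + b * y i) \<le> cmod a * sum_norm n x + cmod b * sum_norm n y"
proof -
  have "sum_norm n (\<lambda>i. a * x i + b * y i) \<le> (\<Sum>i<n. cmod a * cmod (x i) + cmod b * cmod (y i))"
    unfolding sum_norm_def by (intro sum_mono) (metis norm_mult norm_triangle_ineq)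
  then show ?thesis by (simp add: sum_norm_def sum.distrib sum_distrib_left)
qed

lemma sum_norm_cong: "(\<And>i. i < n \<Longrightarrow> x i = y i) \<Longrightarrow> sum_norm n x = sum_norm n y"
  by (simp add: sum_norm_def)

lemma norm_sum_le_sum_norm: "cmod (\<Sum>i<n. x i) \<le> sum_norm n x"
  unfolding sum_norm_def by (rule norm_sum)

lemma norm_weighted_sum_le_sum_norm:
  assumes "\<And>i. i < n \<Longrightarrow> 0 \<le> p i \<and> p i \<le> 1"
  shows "cmod (\<Sum>i<n. of_real (p i) * x i) \<le> sum_norm n x"
proof -
  have "cmod (\<Sum>i<n. of_real (p i) * x i) \<le> (\<Sum>i<n. cmod (of_real (p i) * x i))" by (rule norm_sum)
  also have "\<dots> \<le> sum_norm n x"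
    unfolding sum_norm_def
    by (intro sum_mono) (use assms in \<open>auto simp: norm_mult intro!: mult_left_le_one_le\<close>)
  finally show ?thesis .
qed

text \<open>The angle between \<open>z - 1\<close> and the negative real axis is bounded below when \<open>|z| \<ge> 1\<close>.\<close>

lemma outside_disc_no_cancellation:
  assumes lam: "1 \<le> cmod z" and \<epsilon>: "0 < \<epsilon>" "3 * N * \<epsilon> \<le> 1" and d: "0 \<le> d" "d \<le> N"
  shows "(cmod ((z - 1) / of_real \<epsilon>) + d) / 2 \<le> cmod ((z - 1) / of_real \<epsilon> + of_real d)"
proof -
  define a where "a = (z - 1) / of_real \<epsilon>"
  have ca: "cmod a = cmod (z - 1) / \<epsilon>" using \<epsilon> by (simp add: a_def norm_divide)
  \<comment> \<open>Near 1, \<open>|z| \<ge> 1\<close> forces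
    \<open>Re (z - 1) \<ge> - |z - 1| / 2\<close>, so \<open>a\<close> makes an angle of at least 60
    degrees with the negative axis and the law of cosines applies. Farther away,
    \<open>|a| \<ge> 1 / \<epsilon> \<ge> 3 * d\<close>, so \<open>a\<close> dominates.\<close>
  have "(cmod a + d) / 2 \<le> cmod (a + of_real d)"
  proof (cases "cmod (z - 1) \<le> 1")
    case True
    have "1 \<le> (cmod z)\<^sup>2" using lam by (simp add: one_le_power)
    also have "(cmod z)\<^sup>2 = 1 + 2 * Re (z - 1) + (cmod (z - 1))\<^sup>2"
      unfolding cmod_power2 by (simp add: power2_eq_square algebra_simps)
    also have "(cmod (z - 1))\<^sup>2 \<le> cmod (z - 1) * 1"
      unfolding power2_eq_square using True by (intro mult_left_mono) auto
    finally have "- cmod (z - 1) / 2 \<le> Re (z - 1)" by simp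
    then have "(- cmod (z - 1) / 2) / \<epsilon> \<le> Re (z - 1) / \<epsilon>" using \<epsilon> by (intro divide_right_mono) auto
    then have Re: "- cmod a / 2 \<le> Re a" unfolding ca by (simp add: a_def)
    have "((cmod a + d) / 2)\<^sup>2 = (cmod a)\<^sup>2 + d\<^sup>2 - cmod a * d - 3 / 4 * (cmod a - d)\<^sup>2"
      by (simp add: power2_eq_square field_simps)
    also have "\<dots> \<le> (cmod a)\<^sup>2 + d\<^sup>2 - cmod a * d" by simp
    also have "\<dots> \<le> (cmod a)\<^sup>2 + d\<^sup>2 + 2 * d * Re a"
      using mult_left_mono[OF Re d(1)] by (simp add: algebra_simps)
    also have "\<dots> = (cmod (a + of_real d))\<^sup>2"
      unfolding cmod_power2 by (simp add: power2_eq_square algebra_simps)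
    finally show ?thesis by (rule power2_le_imp_le) simp
  next
    case False
    then have "1 / \<epsilon> \<le> cmod a" unfolding ca using \<epsilon> by (intro divide_right_mono) auto
    moreover have "3 * N \<le> 1 / \<epsilon>" using \<epsilon> by (simp add: pos_le_divide_eq)
    moreover have "cmod a - d \<le> cmod (a + of_real d)"
      using norm_triangle_ineq2[of a "- of_real d"] d by simp
    ultimately have "cmod a - d \<le> cmod (a + of_real d)" "3 * d \<le> cmod a" using d(2) by linarith+
    then show ?thesis by (simp add: field_simps)
  qed
  then show ?thesis by (simp add: a_def)
qed

text \<open>Everything is bounded in terms of \<open>|c|\<close>: \<open>U\<close> by
  \<open>W\<close>, \<open>W\<close> by the sum norm of \<open>u\<close>, and the latter by
  \<open>|c| + U\<close>; small \<open>\<epsilon>\<close> closes this circle. \<open>A\<close> is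
  measured in the sup norm and \<open>B\<close> in the sum norm, and passing from the first to the
  second costs a factor \<open>n\<close>.\<close>

lemma perturbed_spectrum_inside_disc:
  fixes TA TB :: "(nat \<Rightarrow> complex) \<Rightarrow> nat \<Rightarrow> complex" and u w :: "nat \<Rightarrow> complex"
  assumes n: "n > 0"
    and linA: "\<And>x c i. i < n \<Longrightarrow> TA (\<lambda>i. x i - c) i = TA x i - c"
    and linB: "\<And>x c i. i < n \<Longrightarrow> TB (\<lambda>i. x i - c * of_real (v i)) i = TB x i - c * of_real (v i)"
    and contrB: "\<And>x. sum_norm n (TB x) \<le> sum_norm n x"
    and pA: "\<And>x. (\<Sum>i<n. of_real (p i) * TA x i) = (\<Sum>i<n. of_real (p i) * x i)"
    and p: "\<And>i. i < n \<Longrightarrow> p i > 0" "(\<Sum>i<n. p i) = 1"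
    and v: "\<And>i. i < n \<Longrightarrow> v i > 0" "(\<Sum>i<n. v i) = 1"
    and resA: "\<And>x. (\<Sum>i<n. of_real (p i) * x i) = 0 \<Longrightarrow> sup_norm n x \<le> r * sup_norm n (\<lambda>i. z * x i - TA x i)"
    and resB: "\<And>x. (\<Sum>i<n. x i) = 0 \<Longrightarrow> sum_norm n x \<le> r * sum_norm n (\<lambda>i. z * x i - TB x i)"
    and r: "0 \<le> r" and lam: "1 \<le> cmod z" and \<epsilon>: "0 < \<epsilon>"
    and small: "18 * n * \<epsilon> * (r * (3 + 4 * r)) \<le> 1" "16 * n * \<epsilon> * r \<le> 1" "3 * n * \<epsilon> \<le> 1"
    and eq1: "\<And>i. i < n \<Longrightarrow> TA u i + of_real \<epsilon> * w i = z * u i"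
    and eq2: "\<And>i. i < n \<Longrightarrow> u i - TA u i + TB w i - of_real \<epsilon> * w i = z * w i"
    and sum0: "(\<Sum>i<n. u i) + (\<Sum>i<n. w i) = 0"
    and i: "i < n"
  shows "u i = 0 \<and> w i = 0"
proof -
  define c where "c = (\<Sum>i<n. of_real (p i) * u i)"
  define s where "s = (\<Sum>i<n. w i)"
  define \<pi> where "\<pi> = (\<Sum>i<n. of_real (p i) * w i)"
  define q where "q = (\<Sum>i<n. p i * v i)"
  define u' where "u' = (\<lambda>i. u i - c)"
  define w' where "w' = (\<lambda>i. w i - s * of_real (v i))"
  define U where "U = sup_norm n u'"
  define W' where "W' = sum_norm n w'"
  define W where "W = sum_norm n w"
  define V where "V = sum_norm n (\<lambda>i. u i + s * of_real (v i))"
  note nonneg = sup_norm_nonneg[of n u', folded U_def] sum_norm_nonneg[of n w', folded W'_def]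
    sum_norm_nonneg[of n w, folded W_def] sum_norm_nonneg[of n "\<lambda>i. u i + s * of_real (v i)", folded V_def]
  have p1: "0 \<le> p i \<and> p i \<le> 1" if "i < n" for i
    using p(1)[OF that] member_le_sum[of i "{..<n}" p] p that by (auto intro: less_imp_le)
  have sp: "(\<Sum>i<n. of_real (p i)) = (1 :: complex)" using p(2) by (simp flip: of_real_sum)
  have sv: "(\<Sum>i<n. of_real (v i)) = (1 :: complex)" using v(2) by (simp flip: of_real_sum)
  have q: "0 < q" "q \<le> 1"
  proof -
    show "0 < q" unfolding q_def using p v n by (intro sum_pos) auto
    have "q \<le> (\<Sum>i<n. v i)"
      unfolding q_def using p1 v(1) by (intro sum_mono mult_left_le_one_le) (auto intro: less_imp_le)
    then show "q \<le> 1" using v(2) by simp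
  qed
  have s_u: "s = - (\<Sum>i<n. u i)" using sum0 by (simp add: s_def add_eq_0_iff)
  \<comment> \<open>Pairing the first equation with \<open>p\<close> removes \<open>TA\<close>.
    Consequently, subtracting \<open>c\<close> from \<open>u\<close> replaces \<open>w\<close> by
    \<open>w - \<pi>\<close> in the residual, still with the factor
    \<open>\<epsilon>\<close>.\<close>
  have eps_pi: "of_real \<epsilon> * \<pi> = (z - 1) * c"
  proof -
    have "z * c = (\<Sum>i<n. of_real (p i) * (TA u i + of_real \<epsilon> * w i))"
      unfolding c_def sum_distrib_left by (intro sum.cong) (auto simp: eq1)
    also have "\<dots> = c + of_real \<epsilon> * \<pi>"
      by (simp add: distrib_left sum.distrib pA c_def \<pi>_def sum_distrib_left mult.left_commute)
    finally show ?thesis by (simp add: algebra_simps)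
  qed
  have pi_le: "cmod \<pi> \<le> W" unfolding \<pi>_def W_def using p1 by (rule norm_weighted_sum_le_sum_norm)
  have U_le: "U \<le> r * (2 * \<epsilon> * W)"
  proof -
    have "(\<Sum>i<n. of_real (p i) * u' i) = 0"
      by (simp add: u'_def right_diff_distrib sum_subtractf sum_distrib_right[symmetric] sp c_def)
    then have "U \<le> r * sup_norm n (\<lambda>i. z * u' i - TA u' i)" unfolding U_def by (rule resA)
    also have "sup_norm n (\<lambda>i. z * u' i - TA u' i) \<le> 2 * \<epsilon> * W"
    proof (rule sup_norm_le)
      fix i assume i: "i < n"
      have "z * u' i - TA u' i = of_real \<epsilon> * (w i - \<pi>)"
        unfolding right_diff_distrib eps_pi
        using linA[OF i, of u c] eq1[OF i, symmetric]
        by (simp add: u'_def left_diff_distrib right_diff_distrib)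
      then have "cmod (z * u' i - TA u' i) = \<epsilon> * cmod (w i - \<pi>)" using \<epsilon> by (simp add: norm_mult)
      also have "\<dots> \<le> \<epsilon> * (W + W)"
        using sum_norm_ge[OF i, of w] pi_le norm_triangle_ineq4[of "w i" \<pi>] \<epsilon>
        by (intro mult_left_mono) (auto simp: W_def)
      finally show "cmod (z * u' i - TA u' i) \<le> 2 * \<epsilon> * W" by simp
    qed (use \<epsilon> nonneg in simp)
    finally show ?thesis using r by (simp add: mult_left_mono)
  qed
  have u_le: "sum_norm n u \<le> n * (cmod c + U)"
  proof -
    have "cmod (u i) \<le> cmod c + U" if "i < n" for i
      using sup_norm_ge[OF that, of u'] norm_triangle_ineq[of c "u' i"] by (simp add: u'_def U_def)
    then have "sum_norm n u \<le> (\<Sum>i<n. cmod c + U)" unfolding sum_norm_def by (intro sum_mono) simp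
    then show ?thesis by simp
  qed
  have s_le: "cmod s \<le> sum_norm n u" unfolding s_u norm_minus_cancel by (rule norm_sum_le_sum_norm)
  have v_norm: "sum_norm n (\<lambda>i. of_real (v i)) = 1"
    using v by (simp add: sum_norm_def less_imp_le)
  have V_le: "V \<le> 2 * sum_norm n u"
  proof -
    have "V \<le> sum_norm n u + cmod s"
      using sum_norm_lin[of n 1 u s "\<lambda>i. of_real (v i)"] v_norm by (simp add: V_def)
    with s_le show ?thesis by simp
  qed
  have w'0: "(\<Sum>i<n. w' i) = 0"
    by (simp add: w'_def sum_subtractf sum_distrib_left[symmetric] sv s_def)
  \<comment> \<open>Adding the two equations gives \<open>u + TB w = z * (u + w)\<close>, so the
    residual of \<open>w'\<close> is a multiple of \<open>1 - z\<close>, which is of order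
    \<open>\<epsilon>\<close> in the critical range near 1.\<close>
  have Rw': "sum_norm n (\<lambda>i. z * w' i - TB w' i) = cmod (z - 1) * V"
  proof -
    have "z * w' i - TB w' i = (1 - z) * (u i + s * of_real (v i))" if i: "i < n" for i
    proof -
      have "TA u i = z * u i - of_real \<epsilon> * w i" using eq1[OF i] by (simp add: algebra_simps)
      with eq2[OF i] have "TB w i = z * w i + z * u i - u i" by (simp add: algebra_simps)
      then show ?thesis using linB[OF i, of w s] by (simp add: w'_def algebra_simps)
    qed
    then have "sum_norm n (\<lambda>i. z * w' i - TB w' i) = sum_norm n (\<lambda>i. (1 - z) * (u i + s * of_real (v i)))"
      by (rule sum_norm_cong)
    also have "\<dots> = cmod (1 - z) * V" by (simp add: sum_norm_def V_def norm_mult sum_distrib_left)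
    finally show ?thesis by (simp add: norm_minus_commute)
  qed
  have W'1: "W' \<le> r * (cmod (z - 1) * V)" using resB[OF w'0] unfolding W'_def Rw' .
  \<comment> \<open>\<open>W'1\<close> is weak for large \<open>|z|\<close>. Writing
    \<open>z - 1\<close> times \<open>w'\<close> as its residual plus \<open>TB w' - w'\<close> and
    inserting \<open>W'1\<close> for the second term yields a bound uniform in
    \<open>z\<close>.\<close>
  have W'2: "W' \<le> (1 + 2 * r) * V"
  proof (cases "z = 1")
    case True
    then show ?thesis using W'1 nonneg r by simp
  next
    case False
    have "cmod (z - 1) * W' = sum_norm n (\<lambda>i. (z * w' i - TB w' i) + (TB w' i - w' i))"
      unfolding W'_def sum_norm_def sum_distrib_left norm_mult[symmetric] by (simp add: algebra_simps)
    also have "\<dots> \<le> sum_norm n (\<lambda>i. z * w' i - TB w' i) + sum_norm n (\<lambda>i. TB w' i - w' i)"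
      using sum_norm_lin[of n 1 "\<lambda>i. z * w' i - TB w' i" 1 "\<lambda>i. TB w' i - w' i"] by simp
    also have "sum_norm n (\<lambda>i. TB w' i - w' i) \<le> 2 * W'"
      using sum_norm_lin[of n 1 "TB w'" "- 1" w'] contrB[of w'] by (simp add: W'_def)
    also have "\<dots> \<le> 2 * (r * (cmod (z - 1) * V))" using W'1 by simp
    finally have "cmod (z - 1) * W' \<le> cmod (z - 1) * ((1 + 2 * r) * V)"
      unfolding Rw' by (simp add: algebra_simps)
    with False show ?thesis by simp
  qed
  have W_le: "W \<le> (3 + 4 * r) * sum_norm n u"
  proof -
    have "W \<le> cmod s + W'"
      using sum_norm_lin[of n s "\<lambda>i. of_real (v i)" 1 w'] v_norm by (simp add: W_def W'_def w'_def)
    moreover have "(1 + 2 * r) * V \<le> (1 + 2 * r) * (2 * sum_norm n u)"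
      using V_le r by (intro mult_left_mono) auto
    ultimately show ?thesis using s_le W'2 by (simp add: algebra_simps)
  qed
  \<comment> \<open>The constant 18 is 2 from \<open>U_le\<close> times 9, giving
    \<open>U \<le> (|c| + U) / 9\<close>, which is the same as
    \<open>U \<le> |c| / 8\<close>.\<close>
  have U_c: "U \<le> cmod c / 8"
  proof -
    have "W \<le> (3 + 4 * r) * (n * (cmod c + U))"
      using W_le mult_left_mono[OF u_le, of "3 + 4 * r"] r by linarith
    then have "r * (2 * \<epsilon> * W) \<le> r * (2 * \<epsilon> * ((3 + 4 * r) * (n * (cmod c + U))))"
      using r \<epsilon> by (intro mult_left_mono) auto
    also have "\<dots> = (18 * n * \<epsilon> * (r * (3 + 4 * r))) * ((cmod c + U) / 9)" by simp
    also have "\<dots> \<le> 1 * ((cmod c + U) / 9)" using small(1) nonneg by (intro mult_right_mono) auto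
    finally have "r * (2 * \<epsilon> * W) \<le> (cmod c + U) / 9" by simp
    with U_le have "U \<le> (cmod c + U) / 9" by (rule order_trans)
    then show ?thesis by simp
  qed
  define a where "a = (z - 1) / of_real \<epsilon>"
  define d where "d = n * q"
  have d: "0 < d" "d \<le> n" using q n by (auto simp: d_def mult_left_le)
  \<comment> \<open>Evaluate \<open>\<pi>\<close> in two ways: it is \<open>a * c\<close> by
    \<open>eps_pi\<close>, and it is \<open>s * q\<close> plus the contribution of
    \<open>w'\<close>, where \<open>s\<close> is minus the sum of \<open>u\<close> and so about
    \<open>- n * c\<close>.\<close>
  have main: "(a + of_real d) * c = - of_real q * (\<Sum>i<n. u' i) + (\<Sum>i<n. of_real (p i) * w' i)"
  proof -
    have "a * c = \<pi>" using eps_pi \<epsilon> by (simp add: a_def field_simps)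
    also have "\<pi> = (\<Sum>i<n. of_real (p i) * w' i) + s * of_real q"
      by (simp add: \<pi>_def w'_def q_def right_diff_distrib sum_subtractf sum_distrib_left mult.left_commute)
    also have "s = - (of_nat n * c + (\<Sum>i<n. u' i))" unfolding s_u by (simp add: u'_def sum_subtractf)
    finally show ?thesis by (simp add: d_def algebra_simps)
  qed
  have "(cmod a + d) / 2 * cmod c \<le> cmod ((a + of_real d) * c)"
    unfolding norm_mult a_def
    using outside_disc_no_cancellation[OF lam \<epsilon>, of n d] small(3) d by (intro mult_right_mono) auto
  also have "\<dots> \<le> q * cmod (\<Sum>i<n. u' i) + cmod (\<Sum>i<n. of_real (p i) * w' i)"
    unfolding main using norm_triangle_ineq[of "- of_real q * (\<Sum>i<n. u' i)" "\<Sum>i<n. of_real (p i) * w' i"] q(1)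
    by (simp add: norm_mult)
  also have "q * cmod (\<Sum>i<n. u' i) \<le> q * (n * U)"
  proof (rule mult_left_mono)
    have "cmod (\<Sum>i<n. u' i) \<le> (\<Sum>i<n. U)"
      using sup_norm_ge[of _ n u'] by (intro sum_norm_le) (simp add: U_def)
    then show "cmod (\<Sum>i<n. u' i) \<le> n * U" by simp
  qed (use q in simp)
  also have "cmod (\<Sum>i<n. of_real (p i) * w' i) \<le> W'"
    unfolding W'_def using p1 by (rule norm_weighted_sum_le_sum_norm)
  also have "W' \<le> cmod a / 8 * (cmod c + U)"
  proof -
    have "V \<le> 2 * (n * (cmod c + U))" using V_le u_le by linarith
    then have "W' \<le> r * (cmod (z - 1) * (2 * (n * (cmod c + U))))"
      using W'1 r by (meson mult_left_mono norm_ge_zero order_trans)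
    also have "cmod (z - 1) = \<epsilon> * cmod a" using \<epsilon> by (simp add: a_def norm_divide)
    also have "r * (\<epsilon> * cmod a * (2 * (n * (cmod c + U)))) = (16 * n * \<epsilon> * r) * (cmod a / 8 * (cmod c + U))"
      by simp
    also have "\<dots> \<le> 1 * (cmod a / 8 * (cmod c + U))" using small(2) nonneg by (intro mult_right_mono) auto
    finally show ?thesis by simp
  qed
  finally have "(cmod a + d) / 2 * cmod c \<le> d * U + cmod a / 8 * (cmod c + U)" by (simp add: d_def algebra_simps)
  also have "\<dots> \<le> d * (cmod c / 8) + cmod a / 8 * (cmod c + cmod c / 8)"
    using U_c d by (intro add_mono mult_left_mono) auto
  \<comment> \<open>The left side kept \<open>1/2 - 1/8 = 3/8\<close> of both terms, while only
    \<open>1/64\<close> of the \<open>|a|\<close> term survives on the right. Hence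
    \<open>d * |c|\<close> cannot be positive.\<close>
  finally have "(cmod a + d) * cmod c * (3 / 8) \<le> cmod a * cmod c / 64" by (simp add: algebra_simps)
  moreover have "cmod a * cmod c \<ge> 0" by simp
  ultimately have "d * cmod c \<le> 0" unfolding distrib_right by linarith
  then have "cmod c = 0" using d by (simp add: mult_le_0_iff)
  moreover from this have "U = 0" using U_c nonneg by simp
  ultimately have "sum_norm n u \<le> 0" using u_le by simp
  moreover have "(3 + 4 * r) * sum_norm n u \<le> 0" if "sum_norm n u \<le> 0"
    using that r by (intro mult_nonneg_nonpos) auto
  ultimately have "cmod (u i) \<le> 0" "cmod (w i) \<le> 0"
    using sum_norm_ge[OF i, of u] sum_norm_ge[OF i, of w] W_le unfolding W_def by linarith+
  then show ?thesis by simp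
qed

section \<open>Eigenvalue moduli and the size of the parameter range\<close>

lemma char_poly_block_lower_triangular:
  fixes P S :: "'a :: idom mat"
  assumes P: "P \<in> carrier_mat n n" and S: "S \<in> carrier_mat m m" and R: "R \<in> carrier_mat m n"
  shows "char_poly (four_block_mat P (0\<^sub>m n m) R S) = char_poly P * char_poly S"
proof -
  have "char_poly_matrix (four_block_mat P (0\<^sub>m n m) R S)
      = four_block_mat (char_poly_matrix P) (0\<^sub>m n m) (map_mat (\<lambda>a. [:- a:]) R) (char_poly_matrix S)"
    by (rule eq_matI) (use P S R in \<open>auto simp: char_poly_matrix_def\<close>)
  then show ?thesis
    unfolding char_poly_def
    using det_four_block_mat_upper_right_zero[of "char_poly_matrix P" n _ m "map_mat (\<lambda>a. [:- a:]) R" "char_poly_matrix S"]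
      P S R by simp
qed

lemma char_poly_factor_one:
  fixes C :: "complex mat"
  assumes C: "C \<in> carrier_mat n n" and one: "eigenvalue C 1"
  obtains es where "char_poly C = (\<Prod>e\<leftarrow>1 # es. [:- e, 1:])" "length es = n - 1"
proof -
  obtain as where as: "char_poly C = (\<Prod>a\<leftarrow>as. [:- a, 1:])" "length as = n"
    using char_poly_factorized[OF C] by blast
  have "poly (char_poly C) 1 = 0" using one eigenvalue_root_char_poly[OF C] by simp
  then have "1 \<in> set as" unfolding as(1) by (auto simp: poly_prod_list prod_list_zero_iff)
  then have "mset (1 # remove1 1 as) = mset as" by simp
  then have "(\<Prod>a\<leftarrow>1 # remove1 1 as. [:- a, 1:]) = (\<Prod>a\<leftarrow>as. [:- a, 1:])"
    by (simp only: prod_mset_prod_list[symmetric] mset_map)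
  moreover have "length (remove1 1 as) = n - 1" using \<open>1 \<in> set as\<close> as(2) by (simp add: length_remove1)
  ultimately show thesis by (intro that[of "remove1 1 as"]) (simp_all only: as(1))
qed

lemma eigenvalue_char_poly_roots:
  assumes C: "(C :: complex mat) \<in> carrier_mat n n" and es: "char_poly C = (\<Prod>e\<leftarrow>es. [:- e, 1:])"
    and e: "e \<in> set es"
  shows "eigenvalue C e"
  unfolding eigenvalue_root_char_poly[OF C] es using e
  by (auto simp: poly_prod_list prod_list_zero_iff image_iff intro!: bexI[of _ e])

lemma eigenvalue_mat_app:
  fixes C :: "complex mat"
  assumes C: "C \<in> carrier_mat n n" and e: "eigenvalue C e"
  obtains x where "\<And>i. i < n \<Longrightarrow> mat_app n C x i = e * x i" "\<exists>i<n. x i \<noteq> 0"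
proof -
  obtain v where v: "v \<in> carrier_vec n" "v \<noteq> 0\<^sub>v n" "C *\<^sub>v v = e \<cdot>\<^sub>v v"
    using e C by (auto simp: eigenvalue_def eigenvector_def)
  show thesis
  proof (rule that[of "\<lambda>i. v $ i"])
    fix i assume i: "i < n"
    have "mat_app n C (\<lambda>i. v $ i) i = (C *\<^sub>v v) $ i"
      using C v(1) i by (auto simp: mat_app_def scalar_prod_def atLeast0LessThan)
    then show "mat_app n C (\<lambda>i. v $ i) i = e * v $ i" using v(1,3) i by simp
  next
    show "\<exists>i<n. v $ i \<noteq> 0"
    proof (rule ccontr)
      assume "\<not> ?thesis"
      then have "v = 0\<^sub>v n" using v(1) by (intro eq_vecI) auto
      with v(2) show False by simp
    qed
  qed
qed

lemma eigenvalueI_mat_app: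
  fixes C :: "complex mat"
  assumes C: "C \<in> carrier_mat n n" and x: "\<And>i. i < n \<Longrightarrow> mat_app n C x i = e * x i" "i < n" "x i \<noteq> 0"
  shows "eigenvalue C e"
proof -
  have "C *\<^sub>v vec n x = e \<cdot>\<^sub>v vec n x"
    unfolding vec_mat_app[OF C, symmetric] by (rule eq_vecI) (auto simp: x(1))
  moreover have "vec n x \<noteq> 0\<^sub>v n"
  proof
    assume "vec n x = 0\<^sub>v n"
    then have "vec n x $ i = 0\<^sub>v n $ i" by simp
    with x show False by simp
  qed
  ultimately show ?thesis using C by (auto simp: eigenvalue_def eigenvector_def intro!: exI[of _ "vec n x"])
qed

lemma eigenvalue_le_1:
  fixes C :: "complex mat"
  assumes C: "C \<in> carrier_mat n n" and e: "eigenvalue C e"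
    and N: "\<And>a x. N (\<lambda>i. a * x i) = cmod a * N x" "\<And>x y. (\<And>i. i < n \<Longrightarrow> x i = y i) \<Longrightarrow> N x = N y"
      "\<And>x i. i < n \<Longrightarrow> cmod (x i) \<le> N x" "\<And>x. N (mat_app n C x) \<le> N x"
  shows "cmod e \<le> 1"
proof -
  obtain x i where x: "\<And>i. i < n \<Longrightarrow> mat_app n C x i = e * x i" "i < n" "x i \<noteq> 0"
    using eigenvalue_mat_app[OF C e] by blast
  have "cmod e * N x = N (mat_app n C x)" unfolding N(1)[symmetric] by (rule N(2)) (simp add: x(1))
  also have "\<dots> \<le> 1 * N x" using N(4) by simp
  finally have "cmod e * N x \<le> 1 * N x" .
  moreover have "0 < cmod (x i)" using x(3) by simp
  then have "0 < N x" using N(3)[OF x(2), of x] by (rule less_le_trans)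
  ultimately show ?thesis by (rule mult_right_le_imp_le)
qed

text \<open>The two eigenvalues 1 head the decreasing list of moduli, so the third entry is the
  largest modulus among \<open>es\<close>. An empty \<open>es\<close> meets the default value 0 in
  \<open>third_modulus\<close>.\<close>

lemma third_modulus_bounds:
  fixes M :: "real mat"
  assumes cp: "char_poly (map_mat complex_of_real M) = (\<Prod>e\<leftarrow>1 # 1 # es. [:- e, 1:])"
    and es: "\<And>e. e \<in> set es \<Longrightarrow> cmod e \<le> 1"
  shows "\<And>e. e \<in> set es \<Longrightarrow> cmod e \<le> third_modulus M" "0 \<le> third_modulus M" "third_modulus M \<le> 1"
    "es = [] \<Longrightarrow> third_modulus M = 0"
proof -
  define L where "L = sort (map cmod es)"
  have setL: "set L = cmod ` set es" and lenL: "length L = length es" by (simp_all add: L_def)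
  have "proots (\<Prod>e\<leftarrow>as. [:- e, 1:]) = mset as" for as :: "complex list"
  proof (induction as)
    case (Cons a as)
    have "(\<Prod>e\<leftarrow>as. [:- e, 1 :: complex:]) \<noteq> 0" by (auto simp: prod_list_zero_iff)
    with Cons show ?case by (simp add: proots_mult del: mult_pCons_left)
  qed simp
  then have "eigenvalue_moduli M = rev (sort (map cmod (1 # 1 # es)))"
    unfolding eigenvalue_moduli_def cp by (simp add: mset_map[symmetric] del: mset_map mset.simps list.map)
  also have "sort (map cmod (1 # 1 # es)) = L @ [1, 1]"
  proof (rule properties_for_sort)
    show "sorted (L @ [1, 1])"
      using es setL by (auto simp: sorted_append L_def)
  qed (simp add: L_def)
  finally have moduli: "eigenvalue_moduli M = 1 # 1 # rev L" by simp
  have third: "third_modulus M = (if L = [] then 0 else last L)"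
    by (auto simp: third_modulus_def moduli Let_def hd_rev[symmetric] hd_conv_nth numeral_2_eq_2 Suc_le_eq)
  have "x \<le> last L" if "x \<in> set L" for x
  proof -
    have "sorted L" by (simp add: L_def)
    with that show ?thesis by (cases L rule: rev_cases) (auto simp: sorted_append)
  qed
  then show "cmod e \<le> third_modulus M" if "e \<in> set es" for e
    using that setL by (auto simp: third)
  have "last L \<in> cmod ` set es" if "L \<noteq> []" using last_in_set[OF that] setL by simp
  then show "0 \<le> third_modulus M" "third_modulus M \<le> 1"
    using es by (auto simp: third)
  show "es = [] \<Longrightarrow> third_modulus M = 0" by (simp add: third L_def)
qed

text \<open>For \<open>n = 1\<close> one has \<open>r = 0\<close>. For \<open>n \<ge> 2\<close>,
  \<open>(1 - t)^2\<close> times \<open>r * (3 + 4 * r)\<close> is at most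
  \<open>4 * 9 ^ (n - 1)\<close>, so the main condition reduces to
  \<open>8 * n * 9 ^ n \<le> (20 + 8 * n) ^ n\<close>. This follows from
  \<open>8 * n \<le> 4 ^ n\<close> and \<open>20 + 8 * n \<ge> 36\<close>.\<close>

lemma Upsilon_smallness:
  fixes n :: nat and t \<epsilon> :: real
  assumes n: "n > 0" and t: "0 \<le> t" "t \<le> 1" "n = 1 \<Longrightarrow> t = 0"
    and \<epsilon>: "0 < \<epsilon>" "\<epsilon> < 1 / (20 + 8 * real n) ^ n * (1 - t) ^ n"
  defines "r \<equiv> (3 ^ (n - 1) - 1) / (1 - t)"
  shows "t < 1" "18 * n * \<epsilon> * (r * (3 + 4 * r)) \<le> 1" "16 * n * \<epsilon> * r \<le> 1" "3 * n * \<epsilon> \<le> 1"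
proof -
  let ?K = "(20 + 8 * real n) ^ n"
  have K: "?K > 0" by simp
  \<comment> \<open>If \<open>t = 1\<close>, the interval of admissible \<open>\<epsilon>\<close> is
    empty. This takes the place of an aperiodicity assumption on the network.\<close>
  show t1: "t < 1"
  proof (rule ccontr)
    assume "\<not> t < 1"
    with t have "t = 1" by simp
    with \<epsilon> n show False by (simp add: zero_power)
  qed
  have r0: "0 \<le> r" using t1 by (simp add: r_def)
  have pow: "(1 - t) ^ n \<le> 1" using t by (simp add: power_le_one)
  have \<epsilon>K: "?K * \<epsilon> < (1 - t) ^ n" using \<epsilon>(2) K by (simp add: field_simps)
  show "3 * n * \<epsilon> \<le> 1"
  proof -
    have "3 * real n \<le> (20 + 8 * real n) ^ 1" by simp
    also have "\<dots> \<le> ?K" using n by (intro power_increasing) auto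
    finally have "3 * real n * \<epsilon> \<le> ?K * \<epsilon>" using \<epsilon>(1) by (intro mult_right_mono) auto
    then show ?thesis using \<epsilon>K pow by simp
  qed
  show main: "18 * n * \<epsilon> * (r * (3 + 4 * r)) \<le> 1"
  proof (cases "n = 1")
    case True
    then show ?thesis by (simp add: r_def)
  next
    case False
    with n have n2: "n \<ge> 2" by simp
    define T where "T = (3 :: real) ^ (n - 1)"
    have T1: "1 \<le> T" by (simp add: T_def)
    have "(1 - t)\<^sup>2 * (r * (3 + 4 * r)) = (T - 1) * (3 * (1 - t) + 4 * (T - 1))"
    proof -
      have "d\<^sup>2 * (s / d * (3 + 4 * (s / d))) = s * (3 * d + 4 * s)" if "d \<noteq> 0" for d s :: real
        using that by (simp add: power2_eq_square field_simps)
      from this[of "1 - t" "T - 1"] show ?thesis using t1 by (simp add: r_def T_def)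
    qed
    also have "\<dots> \<le> T * (4 * T)" using T1 t t1 by (intro mult_mono) auto
    finally have rT: "(1 - t)\<^sup>2 * (r * (3 + 4 * r)) \<le> 4 * T\<^sup>2" by (simp add: power2_eq_square)
    have "8 * n \<le> 4 ^ n" using n2
    proof (induction n rule: dec_induct)
      case (step m)
      then show ?case by simp
    qed simp
    then have "real (8 * n) \<le> real (4 ^ n)" by (simp only: of_nat_le_iff)
    then have "8 * real n * 9 ^ n \<le> 4 ^ n * 9 ^ n" by (intro mult_right_mono) auto
    also have "\<dots> = 36 ^ n" by (simp flip: power_mult_distrib)
    also have "\<dots> \<le> ?K" using n2 by (intro power_mono) auto
    finally have nK: "8 * real n * 9 ^ n \<le> ?K" .
    have T2: "9 * T\<^sup>2 = 9 ^ n"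
    proof -
      have "T\<^sup>2 = 3 ^ (2 * (n - 1))" by (simp add: T_def power_mult[symmetric] mult.commute)
      also have "\<dots> = 9 ^ (n - 1)" by (simp add: power_mult)
      finally have "T\<^sup>2 = 9 ^ (n - 1)" .
      with n show ?thesis by (simp add: power_eq_if)
    qed
    have "?K * \<epsilon> \<le> (1 - t)\<^sup>2"
      using \<epsilon>K power_decreasing[of 2 n "1 - t"] n2 t by simp
    then have "?K * \<epsilon> * (r * (3 + 4 * r)) \<le> (1 - t)\<^sup>2 * (r * (3 + 4 * r))"
      using r0 by (intro mult_right_mono) auto
    also note rT
    finally have "?K * (\<epsilon> * (r * (3 + 4 * r))) \<le> 4 * T\<^sup>2" by (simp add: mult.assoc)
    then have "18 * n * (?K * (\<epsilon> * (r * (3 + 4 * r)))) \<le> 18 * n * (4 * T\<^sup>2)"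
      by (intro mult_left_mono) auto
    also have "\<dots> = 8 * real n * 9 ^ n" unfolding T2[symmetric] by simp
    also have "\<dots> \<le> ?K" by (rule nK)
    finally have "?K * (18 * n * \<epsilon> * (r * (3 + 4 * r))) \<le> ?K * 1" by (simp add: mult_ac)
    then show ?thesis using K by (rule mult_left_le_imp_le)
  qed
  have "16 * n * \<epsilon> * r \<le> 18 * n * \<epsilon> * (r * (3 + 4 * r))"
  proof -
    have "r * 1 \<le> r * (3 + 4 * r)" using r0 by (intro mult_left_mono) auto
    then have "16 * n * \<epsilon> * r \<le> 16 * n * \<epsilon> * (r * (3 + 4 * r))" using \<epsilon>(1) by (intro mult_left_mono) auto
    also have "\<dots> \<le> 18 * n * \<epsilon> * (r * (3 + 4 * r))" using \<epsilon>(1) r0 by (intro mult_right_mono) auto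
    finally show ?thesis .
  qed
  with main show "16 * n * \<epsilon> * r \<le> 1" by linarith
qed

lemma sup_norm_scale: "sup_norm n (\<lambda>i. a * x i) = cmod a * sup_norm n x"
proof (rule antisym)
  show "sup_norm n (\<lambda>i. a * x i) \<le> cmod a * sup_norm n x"
    using sup_norm_lin[of n a x 0 x] by simp
  show "cmod a * sup_norm n x \<le> sup_norm n (\<lambda>i. a * x i)"
  proof (cases "a = 0")
    case False
    then have "sup_norm n x \<le> inverse (cmod a) * sup_norm n (\<lambda>i. a * x i)"
      using sup_norm_lin[of n "inverse a" "\<lambda>i. a * x i" 0 x] by (simp add: mult.assoc[symmetric] norm_inverse)
    then have "cmod a * sup_norm n x \<le> cmod a * (inverse (cmod a) * sup_norm n (\<lambda>i. a * x i))"
      by (rule mult_left_mono) simp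
    with False show ?thesis by (simp add: mult.assoc[symmetric])
  qed (simp add: sup_norm_nonneg)
qed

lemma sup_norm_cong: "(\<And>i. i < n \<Longrightarrow> x i = y i) \<Longrightarrow> sup_norm n x = sup_norm n y"
  unfolding sup_norm_def by (intro arg_cong[where f = "\<lambda>S. Max (insert 0 S)"] image_cong) auto

lemma sum_norm_scale: "sum_norm n (\<lambda>i. a * x i) = cmod a * sum_norm n x"
  by (simp add: sum_norm_def norm_mult sum_distrib_left)

section \<open>From the network to irreducible weights and the spectrum of M\<close>

lemma strongly_connected_closed_set:
  assumes sc: "strongly_connected (with_proj G)" and V: "pverts G = {..<n}"
    and S: "S \<subseteq> {..<n}" "S \<noteq> {}" "\<And>i j. \<lbrakk>i \<in> S; (i, j) \<in> parcs G\<rbrakk> \<Longrightarrow> j \<in> S"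
  shows "S = {..<n}"
proof -
  obtain i where i: "i \<in> S" using S(2) by blast
  have "j \<in> S" if "j < n" for j
  proof -
    have "i \<rightarrow>\<^sup>*\<^bsub>with_proj G\<^esub> j"
      using sc i S(1) V that unfolding strongly_connected_def by auto
    then have "(i, j) \<in> rtrancl_on {..<n} (parcs G)" by (simp add: reachable_def V)
    then show ?thesis using i by (induction rule: rtrancl_on_induct) (auto intro: S(3))
  qed
  with S(1) show ?thesis by blast
qed

lemma network_arc_less:
  assumes "network n G" "(i, j) \<in> parcs G"
  shows "i < n" "j < n"
proof -
  interpret pair_fin_digraph G using assms(1) by (simp add: network_def)
  show "i < n" "j < n"
    using arc_fst_in_verts[OF assms(2)] arc_snd_in_verts[OF assms(2)] assms(1) by (auto simp: network_def)
qed

lemma strongly_connected_irreducible: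
  assumes net: "network n G" and sc: "strongly_connected (with_proj G)"
    and a: "\<And>i j. (i, j) \<in> parcs G \<Longrightarrow> a i j > 0"
  shows "irreducible_weights n a"
  unfolding irreducible_weights_def
proof (intro allI impI)
  fix S assume S: "S \<subseteq> {..<n}" "S \<noteq> {}" "\<forall>i\<in>S. \<forall>j<n. a i j > 0 \<longrightarrow> j \<in> S"
  show "S = {..<n}"
  proof (rule strongly_connected_closed_set[OF sc _ S(1,2)])
    fix i j assume "i \<in> S" "(i, j) \<in> parcs G"
    then show "j \<in> S" using S(3) a[of i j] network_arc_less[OF net, of i j] by blast
  qed (use net in \<open>simp add: network_def\<close>)
qed

text \<open>The complement of a set that is closed for the transpose is closed for
  \<open>a\<close>.\<close>

lemma irreducible_weights_transpose:
  assumes "irreducible_weights n a"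
  shows "irreducible_weights n (\<lambda>i j. a j i)"
  unfolding irreducible_weights_def
proof (intro allI impI, rule ccontr)
  fix S assume S: "S \<subseteq> {..<n}" "S \<noteq> {}" "\<forall>i\<in>S. \<forall>j<n. a j i > 0 \<longrightarrow> j \<in> S" "S \<noteq> {..<n}"
  have "{..<n} - S = {..<n}"
    by (rule irreducible_weightsD[OF assms]) (use S(1,3,4) in auto)
  with S(1,2) show False by blast
qed

lemma mat_app_of_real:
  assumes "A \<in> carrier_mat n n" "i < n"
  shows "mat_app n (map_mat complex_of_real A) x i = (\<Sum>j<n. of_real (A $$ (i, j)) * x j)"
  using assms by (auto simp: mat_app_def intro!: sum.cong)

text \<open>Supplies the data of \<open>perturbed_spectrum_inside_disc\<close>: \<open>p\<close> and
  \<open>v\<close> come from the stationary distributions of \<open>A\<close> and of the transpose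
  of \<open>B\<close>, and both resolvent bounds use the gap \<open>1 - t\<close>.\<close>

lemma M_matrix_no_outer_eigenvector:
  fixes A B :: "real mat" and u w :: "nat \<Rightarrow> complex"
  assumes net: "network n G" and sc: "strongly_connected (with_proj G)"
    and rowA: "row_weights n G A" and colB: "column_weights n G B"
    and \<epsilon>: "0 < \<epsilon>" "\<epsilon> < Upsilon n A B"
    and z: "1 \<le> cmod z"
    and eq1: "\<And>i. i < n \<Longrightarrow> (\<Sum>j<n. of_real (A $$ (i, j)) * u j) + of_real \<epsilon> * w i = z * u i"
    and eq2: "\<And>i. i < n \<Longrightarrow> u i - (\<Sum>j<n. of_real (A $$ (i, j)) * u j)
      + (\<Sum>j<n. of_real (B $$ (i, j)) * w j) - of_real \<epsilon> * w i = z * w i"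
    and sum0: "(\<Sum>i<n. u i) + (\<Sum>i<n. w i) = 0"
    and i: "i < n"
  shows "u i = 0 \<and> w i = 0"
proof -
  have n: "n > 0" using i by simp
  let ?A = "map_mat complex_of_real A" and ?B = "map_mat complex_of_real B"
  have A: "A \<in> carrier_mat n n" and B: "B \<in> carrier_mat n n"
    using rowA colB by (auto simp: row_weights_def column_weights_def)
  then have cA: "?A \<in> carrier_mat n n" and cB: "?B \<in> carrier_mat n n" by auto
  have A0: "0 \<le> A $$ (i, j)" and B0: "0 \<le> B $$ (i, j)" if "i < n" "j < n" for i j
    using rowA colB that unfolding row_weights_def column_weights_def
    by (metis less_eq_real_def)+
  have rA: "(\<Sum>j<n. A $$ (i, j)) = 1" if "i < n" for i
    using rowA that by (simp add: row_weights_def)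
  have cB1: "(\<Sum>i<n. B $$ (i, j)) = 1" if "j < n" for j
    using colB that by (simp add: column_weights_def)
  have irrA: "irreducible_weights n (\<lambda>i j. A $$ (i, j))"
    using rowA network_arc_less[OF net]
    by (intro strongly_connected_irreducible[OF net sc]) (auto simp: row_weights_def in_nbrs_def)
  have irrB: "irreducible_weights n (\<lambda>i j. B $$ (i, j))"
    using colB network_arc_less[OF net]
    by (intro strongly_connected_irreducible[OF net sc]) (auto simp: column_weights_def out_nbrs_def)
  obtain p where p: "\<And>i. i < n \<Longrightarrow> p i > 0" "(\<Sum>i<n. p i) = 1"
      "\<And>j. j < n \<Longrightarrow> (\<Sum>i<n. p i * A $$ (i, j)) = p j"
    using stationary_distribution_exists[OF n A0 rA irrA] by blast
  obtain v where v: "\<And>i. i < n \<Longrightarrow> v i > 0" "(\<Sum>i<n. v i) = 1"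
      "\<And>j. j < n \<Longrightarrow> (\<Sum>i<n. v i * B $$ (j, i)) = v j"
    using stationary_distribution_exists[OF n B0 cB1 irreducible_weights_transpose[OF irrB]] by blast
  note appA = mat_app_of_real[OF A] and appB = mat_app_of_real[OF B]
  have Ac: "mat_app n ?A (\<lambda>_. c) i = c" if "i < n" for i c
    using rA[OF that] by (simp add: appA[OF that] sum_distrib_right[symmetric] flip: of_real_sum)
  have Bv: "mat_app n ?B (\<lambda>i. of_real (v i)) i = of_real (v i)" if "i < n" for i
    using v(3)[OF that] by (simp add: appB[OF that] mult.commute flip: of_real_sum of_real_mult)
  have contrA: "sup_norm n (mat_app n ?A x) \<le> sup_norm n x" for x
  proof (rule sup_norm_le[OF sup_norm_nonneg])
    fix i assume i: "i < n"
    have "cmod (mat_app n ?A x i) \<le> (\<Sum>j<n. A $$ (i, j) * sup_norm n x)"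
      unfolding appA[OF i] using A0[OF i] sup_norm_ge[of _ n x]
      by (intro sum_norm_le) (auto simp: norm_mult intro!: mult_left_mono)
    then show "cmod (mat_app n ?A x i) \<le> sup_norm n x"
      using rA[OF i] by (simp add: sum_distrib_right[symmetric])
  qed
  have contrB: "sum_norm n (mat_app n ?B x) \<le> sum_norm n x" for x
  proof -
    have "sum_norm n (mat_app n ?B x) \<le> (\<Sum>i<n. \<Sum>j<n. B $$ (i, j) * cmod (x j))"
      unfolding sum_norm_def
    proof (rule sum_mono)
      fix i assume "i \<in> {..<n}"
      then show "cmod (mat_app n ?B x i) \<le> (\<Sum>j<n. B $$ (i, j) * cmod (x j))"
        using B0 by (simp add: appB) (intro sum_norm_le, simp add: norm_mult)
    qed
    also have "\<dots> = sum_norm n x"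
      by (subst sum.swap) (simp add: sum_distrib_right[symmetric] cB1 sum_norm_def)
    finally show ?thesis .
  qed
  have pA: "(\<Sum>i<n. of_real (p i) * mat_app n ?A x i) = (\<Sum>i<n. of_real (p i) * x i)" for x
  proof -
    have "(\<Sum>i<n. of_real (p i) * mat_app n ?A x i) = (\<Sum>i<n. \<Sum>j<n. of_real (p i * A $$ (i, j)) * x j)"
      by (simp add: appA sum_distrib_left mult.assoc)
    also have "\<dots> = (\<Sum>j<n. of_real (\<Sum>i<n. p i * A $$ (i, j)) * x j)"
      by (subst sum.swap) (simp add: sum_distrib_right)
    finally show ?thesis by (simp add: p(3))
  qed
  have sB: "(\<Sum>i<n. mat_app n ?B x i) = (\<Sum>i<n. x i)" for x
  proof -
    have "(\<Sum>i<n. mat_app n ?B x i) = (\<Sum>j<n. of_real (\<Sum>i<n. B $$ (i, j)) * x j)"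
      by (simp add: appB sum_distrib_right) (rule sum.swap)
    then show ?thesis by (simp add: cB1)
  qed
  have simpleA: "x i = 0"
    if "\<And>i. i < n \<Longrightarrow> mat_app n ?A x i = x i" "(\<Sum>i<n. of_real (p i) * x i) = 0" "i < n" for x i
    by (rule irreducible_fixed_vector_zero[OF n A0 rA irrA p _ that(2,3)]) (use that(1) appA in auto)
  have simpleB: "x i = 0"
    if fixx: "\<And>i. i < n \<Longrightarrow> mat_app n ?B x i = x i" and "(\<Sum>i<n. 1 * x i) = 0" and i: "i < n" for x i
  proof -
    \<comment> \<open>Conjugation by the diagonal matrix of \<open>v\<close> makes \<open>B\<close>
      row-stochastic with stationary distribution \<open>v\<close>, and carries its fixed vector
      \<open>x\<close> to \<open>x / v\<close>; the row-stochastic case then applies.\<close>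
    let ?a = "\<lambda>i j. B $$ (i, j) * v j / v i" and ?y = "\<lambda>i. x i / of_real (v i)"
    have nz: "v i \<noteq> 0" if "i < n" for i using v(1)[OF that] by simp
    have "?y i = 0"
    proof (rule irreducible_fixed_vector_zero[of n ?a v ?y i, OF n _ _ _ v(1,2) _ _ _ i])
      show "0 \<le> ?a i j" if "i < n" "j < n" for i j
        using B0[OF that] v(1)[OF that(1)] v(1)[OF that(2)] by simp
      show "(\<Sum>j<n. ?a i j) = 1" if "i < n" for i
        using v(3)[OF that] nz[OF that] by (simp add: sum_divide_distrib[symmetric] mult.commute)
      show "irreducible_weights n ?a"
        unfolding irreducible_weights_def
      proof (intro allI impI)
        fix S assume S: "S \<subseteq> {..<n}" "S \<noteq> {}" "\<forall>i\<in>S. \<forall>j<n. ?a i j > 0 \<longrightarrow> j \<in> S"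
        show "S = {..<n}"
          by (rule irreducible_weightsD[OF irrB S(1,2)]) (use S(1,3) v(1) in auto)
      qed
      show "(\<Sum>i<n. v i * ?a i j) = v j" if "j < n" for j
      proof -
        have "(\<Sum>i<n. v i * ?a i j) = (\<Sum>i<n. B $$ (i, j) * v j)"
          using nz by (intro sum.cong) auto
        then show ?thesis using cB1[OF that] by (simp add: sum_distrib_right[symmetric])
      qed
      show "(\<Sum>j<n. of_real (?a i j) * ?y j) = ?y i" if i: "i < n" for i
      proof -
        have "(\<Sum>j<n. of_real (?a i j) * ?y j) = (\<Sum>j<n. of_real (B $$ (i, j)) * x j / of_real (v i))"
          using nz by (intro sum.cong) auto
        also have "\<dots> = mat_app n ?B x i / of_real (v i)" by (simp add: appB[OF i] sum_divide_distrib)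
        finally show ?thesis by (simp add: fixx[OF i])
      qed
      have "(\<Sum>i<n. of_real (v i) * ?y i) = (\<Sum>i<n. x i)" using nz by (intro sum.cong) auto
      then show "(\<Sum>i<n. of_real (v i) * ?y i) = 0" using that(2) by simp
    qed
    then show ?thesis using nz[OF i] by simp
  qed
  have "eigenvalue ?A 1"
    by (rule eigenvalueI_mat_app[OF cA, where x = "\<lambda>_. 1" and i = i]) (simp_all add: Ac i)
  then obtain esA where esA: "char_poly ?A = (\<Prod>e\<leftarrow>1 # esA. [:- e, 1:])" "length esA = n - 1"
    by (rule char_poly_factor_one[OF cA])
  have "v i \<noteq> 0" using v(1)[OF i] by simp
  then have "eigenvalue ?B 1"
    by (intro eigenvalueI_mat_app[OF cB, where x = "\<lambda>i. of_real (v i)" and i = i]) (simp_all add: Bv i)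
  then obtain esB where esB: "char_poly ?B = (\<Prod>e\<leftarrow>1 # esB. [:- e, 1:])" "length esB = n - 1"
    by (rule char_poly_factor_one[OF cB])
  have le1A: "cmod e \<le> 1" if "e \<in> set esA" for e
  proof (rule eigenvalue_le_1[where N = "sup_norm n"])
    show "eigenvalue ?A e" by (rule eigenvalue_char_poly_roots[OF cA esA(1)]) (use that in simp)
    show "sup_norm n x = sup_norm n y" if "\<And>i. i < n \<Longrightarrow> x i = y i" for x y
      using that by (rule sup_norm_cong)
  qed (fact cA sup_norm_scale sup_norm_ge contrA)+
  have le1B: "cmod e \<le> 1" if "e \<in> set esB" for e
  proof (rule eigenvalue_le_1[where N = "sum_norm n"])
    show "eigenvalue ?B e" by (rule eigenvalue_char_poly_roots[OF cB esB(1)]) (use that in simp)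
    show "sum_norm n x = sum_norm n y" if "\<And>i. i < n \<Longrightarrow> x i = y i" for x y
      using that by (rule sum_norm_cong)
  qed (fact cB sum_norm_scale sum_norm_ge contrB)+
  define t where "t = third_modulus (M_matrix n A B 0)"
  \<comment> \<open>At \<open>\<epsilon> = 0\<close> the upper right block of \<open>M\<close>
    vanishes, so its spectrum is that of \<open>A\<close> together with that of \<open>B\<close>.
    This gives two eigenvalues 1 and a common bound \<open>t\<close> for the others.\<close>
  have cp: "char_poly (map_mat complex_of_real (M_matrix n A B 0)) = (\<Prod>e\<leftarrow>1 # 1 # (esA @ esB). [:- e, 1:])"
  proof -
    have "map_mat complex_of_real (M_matrix n A B 0) = four_block_mat ?A (0\<^sub>m n n) (map_mat of_real (1\<^sub>m n - A)) ?B"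
      by (rule eq_matI) (use A B in \<open>auto simp: M_matrix_def\<close>)
    moreover have "map_mat complex_of_real (1\<^sub>m n - A) \<in> carrier_mat n n" using A by auto
    ultimately have "char_poly (map_mat complex_of_real (M_matrix n A B 0)) = char_poly ?A * char_poly ?B"
      by (simp only: char_poly_block_lower_triangular[OF cA cB])
    then show ?thesis unfolding esA esB by (simp del: mult_pCons_left mult_pCons_right add: mult_ac)
  qed
  note third = third_modulus_bounds[OF cp, folded t_def]
  have le1: "cmod e \<le> 1" if "e \<in> set (esA @ esB)" for e using that le1A le1B by auto
  have t: "0 \<le> t" "t \<le> 1" "n = 1 \<Longrightarrow> t = 0"
    using third(2)[OF le1] third(3)[OF le1] third(4)[OF le1] esA(2) esB(2) by auto
  define r where "r = (3 ^ (n - 1) - 1) / (1 - t)"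
  have "\<epsilon> < 1 / (20 + 8 * real n) ^ n * (1 - t) ^ n" using \<epsilon>(2) by (simp add: Upsilon_def t_def)
  note small = Upsilon_smallness[OF n t \<epsilon>(1) this, folded r_def]
  have moduli: "\<forall>e\<in>set esA. cmod e \<le> 1 - (1 - t)" "\<forall>e\<in>set esB. cmod e \<le> 1 - (1 - t)"
    using third(1)[OF le1] by auto
  have d: "0 < 1 - t" using small(1) by simp
  have resA: "sup_norm n x \<le> r * sup_norm n (\<lambda>i. z * x i - mat_app n ?A x i)"
    if "(\<Sum>i<n. of_real (p i) * x i) = 0" for x
    unfolding r_def
  proof (rule resolvent_bound_on_kernel[where N = "sup_norm n" and l = "\<lambda>i. of_real (p i)" and es = esA])
    show "sup_norm n y = 0" if "\<And>i. i < n \<Longrightarrow> y i = 0" for y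
      using sup_norm_le[of 0 n y] sup_norm_nonneg[of n y] that by simp
    show "y i = 0" if "\<And>i. i < n \<Longrightarrow> mat_app n ?A y i = y i" "(\<Sum>i<n. of_real (p i) * y i) = 0" "i < n" for y i
      using that by (rule simpleA)
  qed (fact cA n sup_norm_nonneg sup_norm_lin contrA sup_norm_ge pA esA(1) moduli(1) d z that)+
  have resB: "sum_norm n x \<le> r * sum_norm n (\<lambda>i. z * x i - mat_app n ?B x i)"
    if "(\<Sum>i<n. x i) = 0" for x
    unfolding r_def
  proof (rule resolvent_bound_on_kernel[where N = "sum_norm n" and l = "\<lambda>_. 1" and es = esB])
    show "y i = 0" if "\<And>i. i < n \<Longrightarrow> mat_app n ?B y i = y i" "(\<Sum>i<n. 1 * y i) = 0" "i < n" for y i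
      using that by (rule simpleB)
    show "(\<Sum>i<n. 1 * mat_app n ?B y i) = (\<Sum>i<n. 1 * y i)" for y using sB[of y] by simp
    show "(\<Sum>i<n. 1 * x i) = 0" using that by simp
    show "sum_norm n y = 0" if "\<And>i. i < n \<Longrightarrow> y i = 0" for y using that by (simp add: sum_norm_def)
  qed (fact cB n sum_norm_nonneg sum_norm_lin contrB sum_norm_ge esB(1) moduli(2) d z)+
  have r0: "0 \<le> r" using small(1) by (simp add: r_def)
  show ?thesis
  proof (rule perturbed_spectrum_inside_disc[where TA = "mat_app n ?A" and TB = "mat_app n ?B" and p = p and v = v,
        OF n _ _ contrB pA p(1,2) v(1,2) resA resB r0 z \<epsilon>(1) small(2-4) _ _ sum0 i])
    show "mat_app n ?A (\<lambda>i. x i - c) i = mat_app n ?A x i - c" if "i < n" for x c i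
      using fun_cong[OF mat_app_lin[of n ?A 1 x "- 1" "\<lambda>_. c"], of i] Ac[OF that] by simp
    show "mat_app n ?B (\<lambda>i. x i - c * of_real (v i)) i = mat_app n ?B x i - c * of_real (v i)" if "i < n" for x c i
      using fun_cong[OF mat_app_lin[of n ?B 1 x "- c" "\<lambda>i. of_real (v i)"], of i] Bv[OF that] by simp
  qed (use eq1 eq2 in \<open>simp_all add: appA appB\<close>)
qed

section \<open>Consensus error\<close>

lemma pow_smult_mat:
  fixes K :: "'a :: field mat"
  assumes "K \<in> carrier_mat m m"
  shows "(c \<cdot>\<^sub>m K) ^\<^sub>m k = c ^ k \<cdot>\<^sub>m (K ^\<^sub>m k)"
proof (induction k)
  case (Suc k)
  have "(c \<cdot>\<^sub>m K) ^\<^sub>m Suc k = (c ^ k \<cdot>\<^sub>m (K ^\<^sub>m k)) * (c \<cdot>\<^sub>m K)" by (simp add: Suc)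
  also have "\<dots> = c ^ k \<cdot>\<^sub>m ((K ^\<^sub>m k) * (c \<cdot>\<^sub>m K))"
    using assms by (intro mult_smult_assoc_mat[of _ m m _ m]) auto
  also have "(K ^\<^sub>m k) * (c \<cdot>\<^sub>m K) = c \<cdot>\<^sub>m (K ^\<^sub>m k * K)"
    using assms by (intro mult_smult_distrib[of _ m m _ m]) auto
  also have "c ^ k \<cdot>\<^sub>m (c \<cdot>\<^sub>m (K ^\<^sub>m k * K)) = c ^ Suc k \<cdot>\<^sub>m (K ^\<^sub>m Suc k)"
    by (rule eq_matI) auto
  finally show ?case .
qed (use assms in auto)

text \<open>Choose \<open>\<gamma>\<close> strictly between the spectral radius and 1. The rescaled
  matrix \<open>K = N / \<gamma>\<close> still has spectral radius below 1, so its powers are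
  bounded.\<close>

lemma geometric_power_bound:
  fixes N :: "real mat"
  assumes N: "N \<in> carrier_mat m m" and m: "m > 0"
    and inside: "\<And>e. eigenvalue (map_mat complex_of_real N) e \<Longrightarrow> cmod e < 1"
  obtains C \<gamma> where "0 \<le> C" "0 \<le> \<gamma>" "\<gamma> < 1"
    "\<And>k i j. \<lbrakk>i < m; j < m\<rbrakk> \<Longrightarrow> \<bar>(N ^\<^sub>m k) $$ (i, j)\<bar> \<le> C * \<gamma> ^ k"
proof -
  let ?N = "map_mat complex_of_real N"
  have cN: "?N \<in> carrier_mat m m" using N by simp
  define s where "s = spectral_radius ?N"
  have s: "0 \<le> s" "s < 1"
    using spectral_radius_mem_max(1)[OF cN m] inside by (auto simp: s_def spectrum_def)
  define \<gamma> where "\<gamma> = (s + 1) / 2"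
  have \<gamma>: "0 < \<gamma>" "\<gamma> < 1" "s < \<gamma>" using s by (auto simp: \<gamma>_def)
  define K where "K = complex_of_real (1 / \<gamma>) \<cdot>\<^sub>m ?N"
  have K: "K \<in> carrier_mat m m" using cN by (simp add: K_def)
  have NK: "?N = complex_of_real \<gamma> \<cdot>\<^sub>m K" using \<gamma>(1) by (intro eq_matI) (auto simp: K_def)
  have "spectral_radius K < 1"
  proof -
    obtain e where e: "eigenvalue K e" "spectral_radius K = cmod e"
      using spectral_radius_mem_max(1)[OF K m] by (auto simp: spectrum_def)
    obtain v where v: "v \<in> carrier_vec m" "v \<noteq> 0\<^sub>v m" "K *\<^sub>v v = e \<cdot>\<^sub>v v"
      using e(1) K by (auto simp: eigenvalue_def eigenvector_def)
    have "?N *\<^sub>v v = complex_of_real \<gamma> \<cdot>\<^sub>v (K *\<^sub>v v)"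
      unfolding NK using K v(1) by (intro eq_vecI) (auto simp: scalar_prod_def sum_distrib_left mult.assoc)
    also have "\<dots> = (complex_of_real \<gamma> * e) \<cdot>\<^sub>v v" unfolding v(3) by (simp add: smult_smult_assoc)
    finally have "eigenvalue ?N (complex_of_real \<gamma> * e)"
      using v cN by (auto simp: eigenvalue_def eigenvector_def)
    then have "cmod (complex_of_real \<gamma> * e) \<le> s"
      unfolding s_def by (intro spectral_radius_mem_max(2)[OF cN m]) (simp add: spectrum_def)
    then have "\<gamma> * cmod e \<le> s" using \<gamma>(1) by (simp add: norm_mult)
    with \<gamma>(3) have "\<gamma> * cmod e < \<gamma> * 1" by linarith
    then show ?thesis using \<gamma>(1) e(2) by simp
  qed
  moreover have "\<exists>n_as. jordan_nf K n_as"
    using char_poly_factorized[OF K] jordan_nf_iff_linear_factorization[OF K] by blast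
  ultimately obtain c where c: "norm_bound (K ^\<^sub>m k) c" for k
    using spectral_radius_jnf_norm_bound_less_1[OF K] by blast
  show thesis
  proof (rule that[of "max c 0" \<gamma>])
    fix k i j assume ij: "i < m" "j < m"
    have "map_mat complex_of_real (N ^\<^sub>m k) = complex_of_real \<gamma> ^ k \<cdot>\<^sub>m (K ^\<^sub>m k)"
      unfolding of_real_hom.mat_hom_pow[OF N] NK by (rule pow_smult_mat[OF K])
    then have "map_mat complex_of_real (N ^\<^sub>m k) $$ (i, j) = (complex_of_real \<gamma> ^ k \<cdot>\<^sub>m (K ^\<^sub>m k)) $$ (i, j)"
      by (rule arg_cong)
    then have eq: "complex_of_real ((N ^\<^sub>m k) $$ (i, j)) = complex_of_real \<gamma> ^ k * (K ^\<^sub>m k) $$ (i, j)"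
      using ij N K by simp
    have "\<bar>(N ^\<^sub>m k) $$ (i, j)\<bar> = \<gamma> ^ k * cmod ((K ^\<^sub>m k) $$ (i, j))"
    proof -
      have "\<bar>(N ^\<^sub>m k) $$ (i, j)\<bar> = cmod (complex_of_real ((N ^\<^sub>m k) $$ (i, j)))"
        by (rule norm_of_real[symmetric])
      also have "\<dots> = cmod (complex_of_real \<gamma> ^ k * (K ^\<^sub>m k) $$ (i, j))" by (simp only: eq)
      finally show ?thesis using \<gamma>(1) by (simp add: norm_mult norm_power)
    qed
    also have "\<dots> \<le> \<gamma> ^ k * max c 0"
    proof (rule mult_left_mono)
      have "cmod ((K ^\<^sub>m k) $$ (i, j)) \<le> c"
        using c[of k] ij K by (simp add: norm_bound_def)
      then show "cmod ((K ^\<^sub>m k) $$ (i, j)) \<le> max c 0" by simp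
    qed (use \<gamma> in simp)
    finally show "\<bar>(N ^\<^sub>m k) $$ (i, j)\<bar> \<le> max c 0 * \<gamma> ^ k" by (simp add: mult.commute)
  qed (use \<gamma> in auto)
qed

text \<open>\<open>E\<close> is the convolution of the steps with a geometric sequence, defined by
  its recursion so that \<open>summable_squares_of_contraction\<close> applies directly.\<close>

lemma linear_recursion_square_summable:
  fixes d h :: "nat \<Rightarrow> nat \<Rightarrow> 'a::real_normed_vector" and N :: "real mat"
  assumes N: "N \<in> carrier_mat m m"
    and decay: "0 \<le> C" "0 \<le> \<gamma>" "\<gamma> < 1"
      "\<And>k i j. \<lbrakk>i < m; j < m\<rbrakk> \<Longrightarrow> \<bar>(N ^\<^sub>m k) $$ (i, j)\<bar> \<le> C * \<gamma> ^ k"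
    and rec: "\<And>k i. i < m \<Longrightarrow> d (Suc k) i = (\<Sum>j<m. N $$ (i, j) *\<^sub>R d k j) - \<alpha> k *\<^sub>R h k i"
    and \<alpha>: "\<And>k. 0 \<le> \<alpha> k" "summable (\<lambda>k. (\<alpha> k)\<^sup>2)"
    and h: "\<And>k i. i < m \<Longrightarrow> norm (h k i) \<le> H"
  obtains E where "\<And>k i. i < m \<Longrightarrow> norm (d k i) \<le> E k" "summable (\<lambda>k. (E k)\<^sup>2)"
proof -
  define S where "S = (\<Sum>j<m. norm (d 0 j))"
  define E where "E = rec_nat (C * S) (\<lambda>k e. \<gamma> * e + (C * m * H) * \<alpha> k)"
  have E_Suc: "E (Suc k) = \<gamma> * E k + (C * m * H) * \<alpha> k" for k by (simp add: E_def)
  \<comment> \<open>Bounding all images \<open>N^l d_k\<close> at once lets the induction on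
    \<open>k\<close> move one factor \<open>N\<close> into the power. A direct bound on
    \<open>d_k\<close> would fail, since a single application of \<open>N\<close> need not
    contract.\<close>
  have bd: "norm (\<Sum>j<m. (N ^\<^sub>m l) $$ (i, j) *\<^sub>R d k j) \<le> \<gamma> ^ l * E k" if i: "i < m" for l k i
  proof (induction k arbitrary: l)
    case 0
    have "norm (\<Sum>j<m. (N ^\<^sub>m l) $$ (i, j) *\<^sub>R d 0 j) \<le> (\<Sum>j<m. (C * \<gamma> ^ l) * norm (d 0 j))"
      using decay(4)[OF i] by (intro sum_norm_le) (auto intro!: mult_right_mono)
    also have "\<dots> = \<gamma> ^ l * E 0" by (simp add: E_def S_def sum_distrib_left mult_ac)
    finally show ?case .
  next
    case (Suc k)
    have "(\<Sum>j<m. (N ^\<^sub>m l) $$ (i, j) *\<^sub>R (\<Sum>q<m. N $$ (j, q) *\<^sub>R d k q))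
        = (\<Sum>q<m. (\<Sum>j<m. (N ^\<^sub>m l) $$ (i, j) * N $$ (j, q)) *\<^sub>R d k q)"
      by (simp add: scaleR_sum_right scaleR_sum_left) (rule sum.swap)
    also have "\<dots> = (\<Sum>q<m. (N ^\<^sub>m Suc l) $$ (i, q) *\<^sub>R d k q)"
      using N i by (intro sum.cong) (auto simp: scalar_prod_def atLeast0LessThan)
    finally have eq: "(\<Sum>j<m. (N ^\<^sub>m l) $$ (i, j) *\<^sub>R d (Suc k) j)
        = (\<Sum>q<m. (N ^\<^sub>m Suc l) $$ (i, q) *\<^sub>R d k q) - (\<Sum>j<m. (N ^\<^sub>m l) $$ (i, j) *\<^sub>R \<alpha> k *\<^sub>R h k j)"
      by (simp add: rec scaleR_diff_right sum_subtractf del: pow_mat.simps)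
    have "norm (\<Sum>j<m. (N ^\<^sub>m l) $$ (i, j) *\<^sub>R \<alpha> k *\<^sub>R h k j) \<le> (\<Sum>j<m. (C * \<gamma> ^ l) * (\<alpha> k * H))"
    proof (rule sum_norm_le)
      fix j assume "j \<in> {..<m}"
      then have j: "j < m" by simp
      have le: "\<alpha> k * norm (h k j) \<le> \<alpha> k * H" by (rule mult_left_mono[OF h[OF j] \<alpha>(1)])
      have "\<bar>(N ^\<^sub>m l) $$ (i, j)\<bar> * (\<alpha> k * norm (h k j)) \<le> (C * \<gamma> ^ l) * (\<alpha> k * H)"
        by (rule mult_mono[OF decay(4)[OF i j] le]) (use decay(1,2) \<alpha>(1) in simp_all)
      moreover have "norm ((N ^\<^sub>m l) $$ (i, j) *\<^sub>R \<alpha> k *\<^sub>R h k j)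
          = \<bar>(N ^\<^sub>m l) $$ (i, j)\<bar> * (\<alpha> k * norm (h k j))"
        using \<alpha>(1)[of k] by (simp add: abs_mult)
      ultimately show "norm ((N ^\<^sub>m l) $$ (i, j) *\<^sub>R \<alpha> k *\<^sub>R h k j) \<le> (C * \<gamma> ^ l) * (\<alpha> k * H)"
        by (simp only:)
    qed
    with Suc[of "Suc l"] have "norm (\<Sum>j<m. (N ^\<^sub>m l) $$ (i, j) *\<^sub>R d (Suc k) j)
        \<le> \<gamma> ^ Suc l * E k + (\<Sum>j<m. (C * \<gamma> ^ l) * (\<alpha> k * H))"
      unfolding eq by (meson add_mono norm_triangle_ineq4 order_trans)
    also have "\<gamma> ^ Suc l * E k + (\<Sum>j<m. (C * \<gamma> ^ l) * (\<alpha> k * H)) = \<gamma> ^ l * E (Suc k)"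
      by (simp add: E_Suc algebra_simps)
    finally show ?case by simp
  qed
  show thesis
  proof (rule that)
    show "norm (d k i) \<le> E k" if i: "i < m" for k i
    proof -
      have "(\<Sum>j<m. (N ^\<^sub>m 0) $$ (i, j) *\<^sub>R d k j) = (\<Sum>j<m. if i = j then d k j else 0)"
        using N i by (intro sum.cong) auto
      then show ?thesis using bd[OF i, of 0 k] i by simp
    qed
    show "summable (\<lambda>k. (E k)\<^sup>2)"
      by (rule summable_squares_of_contraction[OF E_Suc \<alpha>(2) decay(2,3)])
  qed
qed

lemma sum_lessThan_add_split:
  fixes f :: "nat \<Rightarrow> 'a::comm_monoid_add"
  shows "(\<Sum>j<n + m. f j) = (\<Sum>j<n. f j) + (\<Sum>j<m. f (n + j))"
  by (induction m) (simp_all add: add.assoc)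

text \<open>Subtracting the spectral projection of \<open>M\<close> at 1, whose range is spanned by \<open>(1, 0)\<close> and whose
  kernel consists of the vectors with entry sum 0.\<close>

definition deviation_matrix :: "nat \<Rightarrow> real mat \<Rightarrow> real mat \<Rightarrow> real \<Rightarrow> real mat" where
  "deviation_matrix n A B \<epsilon> =
    M_matrix n A B \<epsilon> - mat (n + n) (n + n) (\<lambda>(i, j). if i < n then 1 / n else 0)"

text \<open>Stated over any real vector space because it serves both complex eigenvectors and the
  vectors held by the agents.\<close>

lemma deviation_matrix_apply:
  fixes d :: "nat \<Rightarrow> 'a::real_vector"
  assumes A: "A \<in> carrier_mat n n" and B: "B \<in> carrier_mat n n" and i: "i < n"
  shows "(\<Sum>j<n + n. deviation_matrix n A B \<epsilon> $$ (i, j) *\<^sub>R d j) =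
      (\<Sum>j<n. A $$ (i, j) *\<^sub>R d j) + \<epsilon> *\<^sub>R d (n + i) - (1 / n) *\<^sub>R (\<Sum>j<n + n. d j)"
    "(\<Sum>j<n + n. deviation_matrix n A B \<epsilon> $$ (n + i, j) *\<^sub>R d j) =
      d i - (\<Sum>j<n. A $$ (i, j) *\<^sub>R d j) + (\<Sum>j<n. B $$ (i, j) *\<^sub>R d (n + j)) - \<epsilon> *\<^sub>R d (n + i)"
proof -
  have delta: "(\<Sum>j<n. (if i = j then c else 0) *\<^sub>R v j) = c *\<^sub>R v i" for c and v :: "nat \<Rightarrow> 'a"
  proof -
    have "(\<Sum>j<n. (if i = j then c else 0) *\<^sub>R v j) = (\<Sum>j<n. if i = j then c *\<^sub>R v j else 0)"
      by (intro sum.cong) auto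
    then show ?thesis using i by simp
  qed
  have "(\<Sum>j<n. deviation_matrix n A B \<epsilon> $$ (i, j) *\<^sub>R d j)
      = (\<Sum>j<n. A $$ (i, j) *\<^sub>R d j - (1 / n) *\<^sub>R d j)"
    using A B i by (intro sum.cong) (auto simp: deviation_matrix_def M_matrix_def scaleR_diff_left)
  moreover have "(\<Sum>j<n. deviation_matrix n A B \<epsilon> $$ (i, n + j) *\<^sub>R d (n + j))
      = (\<Sum>j<n. (if i = j then \<epsilon> else 0) *\<^sub>R d (n + j) - (1 / n) *\<^sub>R d (n + j))"
    using A B i by (intro sum.cong) (auto simp: deviation_matrix_def M_matrix_def scaleR_diff_left)
  ultimately show "(\<Sum>j<n + n. deviation_matrix n A B \<epsilon> $$ (i, j) *\<^sub>R d j) =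
      (\<Sum>j<n. A $$ (i, j) *\<^sub>R d j) + \<epsilon> *\<^sub>R d (n + i) - (1 / n) *\<^sub>R (\<Sum>j<n + n. d j)"
    by (simp only: sum_lessThan_add_split sum_subtractf delta)
      (simp add: scaleR_sum_right[symmetric] scaleR_add_right)
  have "(\<Sum>j<n. deviation_matrix n A B \<epsilon> $$ (n + i, j) *\<^sub>R d j)
      = (\<Sum>j<n. (if i = j then 1 else 0) *\<^sub>R d j - A $$ (i, j) *\<^sub>R d j)"
    using A B i by (intro sum.cong) (auto simp: deviation_matrix_def M_matrix_def scaleR_diff_left)
  moreover have "(\<Sum>j<n. deviation_matrix n A B \<epsilon> $$ (n + i, n + j) *\<^sub>R d (n + j))
      = (\<Sum>j<n. B $$ (i, j) *\<^sub>R d (n + j) - (if i = j then \<epsilon> else 0) *\<^sub>R d (n + j))"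
    using A B i by (intro sum.cong) (auto simp: deviation_matrix_def M_matrix_def scaleR_diff_left)
  ultimately show "(\<Sum>j<n + n. deviation_matrix n A B \<epsilon> $$ (n + i, j) *\<^sub>R d j) =
      d i - (\<Sum>j<n. A $$ (i, j) *\<^sub>R d j) + (\<Sum>j<n. B $$ (i, j) *\<^sub>R d (n + j)) - \<epsilon> *\<^sub>R d (n + i)"
    by (simp only: sum_lessThan_add_split sum_subtractf delta) simp
qed

text \<open>The columns of \<open>M\<close> sum to 1 and those of the subtracted matrix do too, so
  an eigenvector for a nonzero eigenvalue has entry sum 0. On such vectors the deviation matrix acts
  as \<open>M\<close>.\<close>

lemma deviation_matrix_eigenvalues:
  assumes net: "network n G" and sc: "strongly_connected (with_proj G)"
    and rowA: "row_weights n G A" and colB: "column_weights n G B"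
    and \<epsilon>: "0 < \<epsilon>" "\<epsilon> < Upsilon n A B"
    and e: "eigenvalue (map_mat complex_of_real (deviation_matrix n A B \<epsilon>)) e"
  shows "cmod e < 1"
proof (rule ccontr)
  assume "\<not> cmod e < 1"
  then have e1: "1 \<le> cmod e" by simp
  let ?D = "deviation_matrix n A B \<epsilon>"
  have A: "A \<in> carrier_mat n n" and B: "B \<in> carrier_mat n n"
    using rowA colB by (auto simp: row_weights_def column_weights_def)
  have D: "?D \<in> carrier_mat (n + n) (n + n)" by (simp add: deviation_matrix_def minus_mat_def)
  obtain d where d: "\<And>i. i < n + n \<Longrightarrow> mat_app (n + n) (map_mat complex_of_real ?D) d i = e * d i"
      "\<exists>i<n + n. d i \<noteq> 0"
    using eigenvalue_mat_app[OF map_carrier_mat[THEN iffD2, OF D] e] by blast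
  have row: "(\<Sum>j<n + n. ?D $$ (i, j) *\<^sub>R d j) = e * d i" if "i < n + n" for i
    using d(1)[OF that] by (simp add: mat_app_of_real[OF D that] scaleR_conv_of_real)
  have r1: "(\<Sum>j<n. A $$ (i, j) *\<^sub>R d j) + \<epsilon> *\<^sub>R d (n + i) - (1 / n) *\<^sub>R (\<Sum>j<n + n. d j) = e * d i"
    and r2: "d i - (\<Sum>j<n. A $$ (i, j) *\<^sub>R d j) + (\<Sum>j<n. B $$ (i, j) *\<^sub>R d (n + j)) - \<epsilon> *\<^sub>R d (n + i)
      = e * d (n + i)" if "i < n" for i
    using row[of i] row[of "n + i"] deviation_matrix_apply[OF A B that, of \<epsilon> d] that by simp_all
  have sB: "(\<Sum>i<n. \<Sum>j<n. B $$ (i, j) *\<^sub>R d (n + j)) = (\<Sum>j<n. d (n + j))"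
    using colB by (subst sum.swap) (simp add: scaleR_sum_left[symmetric] column_weights_def)
  have n0: "n > 0" using d(2) by (cases n) auto
  have sum0: "(\<Sum>j<n + n. d j) = 0"
  proof -
    let ?s = "\<Sum>j<n + n. d j"
    have "e * ?s = (\<Sum>i<n. e * d i + e * d (n + i))"
      by (simp add: sum_lessThan_add_split sum.distrib sum_distrib_left distrib_left)
    also have "\<dots> = (\<Sum>i<n. d i + (\<Sum>j<n. B $$ (i, j) *\<^sub>R d (n + j)) - (1 / n) *\<^sub>R ?s)"
      by (intro sum.cong refl) (simp only: r1[symmetric] r2[symmetric] lessThan_iff, simp)
    also have "\<dots> = (\<Sum>i<n. d i) + (\<Sum>j<n. d (n + j)) - ?s"
    proof -
      have "(\<Sum>i<n. (1 / n) *\<^sub>R ?s) = ?s" using n0 by (simp add: sum_constant_scaleR del: sum_constant)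
      then show ?thesis by (simp only: sum.distrib sum_subtractf sB)
    qed
    also have "\<dots> = 0" by (simp add: sum_lessThan_add_split)
    finally show ?thesis using e1 by auto
  qed
  have zero: "d i = 0 \<and> d (n + i) = 0" if "i < n" for i
  proof (rule M_matrix_no_outer_eigenvector[where u = d and w = "\<lambda>i. d (n + i)",
        OF net sc rowA colB \<epsilon> e1 _ _ _ that])
    show "(\<Sum>j<n. of_real (A $$ (i, j)) * d j) + of_real \<epsilon> * d (n + i) = e * d i" if "i < n" for i
      using r1[OF that] sum0 by (simp add: scaleR_conv_of_real)
    show "d i - (\<Sum>j<n. of_real (A $$ (i, j)) * d j) + (\<Sum>j<n. of_real (B $$ (i, j)) * d (n + j))
        - of_real \<epsilon> * d (n + i) = e * d (n + i)" if "i < n" for i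
      using r2[OF that] by (simp add: scaleR_conv_of_real)
    show "(\<Sum>i<n. d i) + (\<Sum>i<n. d (n + i)) = 0" using sum0 by (simp add: sum_lessThan_add_split)
  qed
  obtain i where i: "i < n + n" "d i \<noteq> 0" using d(2) by blast
  show False
  proof (cases "i < n")
    case True
    with zero i show False by blast
  next
    case False
    then have "i - n < n" "n + (i - n) = i" using i(1) by linarith+
    with zero[of "i - n"] i(2) show False by simp
  qed
qed

section \<open>Convergence of the algorithm\<close>

theorem theorem1:
  fixes n :: nat
    and G :: "nat pair_pre_digraph"
    and A B :: "real mat"
    and f :: "nat \<Rightarrow> 'a::euclidean_space \<Rightarrow> real"
    and F :: "'a \<Rightarrow> real"
    and D fstar \<epsilon> :: real
    and \<alpha> :: "nat \<Rightarrow> real"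
    and g x y z :: "nat \<Rightarrow> nat \<Rightarrow> 'a"
  assumes "network n G"
    and "strongly_connected (with_proj G)"
    and "row_weights n G A"
    and "column_weights n G B"
    and "\<And>i. i < n \<Longrightarrow> convex_on UNIV (f i)"
    and "\<And>i u v. i < n \<Longrightarrow> v \<in> subgradients (f i) u \<Longrightarrow> norm v \<le> D"
    and "F = (\<lambda>u. \<Sum>i<n. f i u)"
    and "\<exists>u. F u = fstar"
    and "\<And>u. fstar \<le> F u"
    and "\<epsilon> \<in> {0<..<Upsilon n A B}"
    and "\<And>k. \<alpha> k \<ge> 0"
    and "filterlim (\<lambda>K. \<Sum>k<K. \<alpha> k) at_top sequentially"
    and "summable (\<lambda>k. (\<alpha> k)\<^sup>2)"
    and "d_dgd n A B \<epsilon> \<alpha> f g x y"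
    and "z = stacked n x y"
  shows "\<forall>i<n. (\<lambda>k. F (z k i)) \<longlonglongrightarrow> fstar"
proof (intro allI impI)
  fix i assume i: "i < n"
  then have n: "n > 0" by simp
  have \<epsilon>: "0 < \<epsilon>" "\<epsilon> < Upsilon n A B" using assms(10) by auto
  have A: "A \<in> carrier_mat n n" and B: "B \<in> carrier_mat n n"
    using assms(3,4) by (auto simp: row_weights_def column_weights_def)
  have rowA: "(\<Sum>j<n. A $$ (i, j)) = 1" if "i < n" for i
    using assms(3) that by (simp add: row_weights_def)
  have colB: "(\<Sum>i<n. B $$ (i, j)) = 1" if "j < n" for j
    using assms(4) that by (simp add: column_weights_def)
  note run = assms(14)[unfolded d_dgd_def, rule_format]
  have g: "g k i \<in> subgradients (f i) (x k i)" if "i < n" for k i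
    using run[OF that] by blast
  have x: "x (Suc k) i = (\<Sum>j<n. A $$ (i, j) *\<^sub>R x k j) + \<epsilon> *\<^sub>R y k i - \<alpha> k *\<^sub>R g k i"
    if "i < n" for k i
    using run[OF that] by blast
  have y: "y (Suc k) i = x k i - (\<Sum>j<n. A $$ (i, j) *\<^sub>R x k j)
      + (\<Sum>j<n. B $$ (i, j) *\<^sub>R y k j) - \<epsilon> *\<^sub>R y k i" if "i < n" for k i
    using run[OF that] by blast
  define zb where "zb k = (1 / n) *\<^sub>R ((\<Sum>i<n. x k i) + (\<Sum>i<n. y k i))" for k
  \<comment> \<open>Only the first block is shifted by \<open>zb\<close>: the eigenvector of
    \<open>M\<close> for 1 is \<open>(1, 0)\<close>, so the \<open>y\<close> components are already
    deviations from 0.\<close>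
  define d where "d = stacked n (\<lambda>k i. x k i - zb k) y"
  \<comment> \<open>The mean of the subgradients is subtracted because \<open>zb\<close> moves along
    it in the same step.\<close>
  define h where "h k i = (if i < n then g k i - (1 / n) *\<^sub>R (\<Sum>j<n. g k j) else 0)" for k i
  let ?D = "deviation_matrix n A B \<epsilon>"
  have D: "?D \<in> carrier_mat (n + n) (n + n)" by (simp add: deviation_matrix_def minus_mat_def)
  have zb_Suc: "zb (Suc k) = zb k - (\<alpha> k / n) *\<^sub>R (\<Sum>i<n. g k i)" for k
  proof -
    have "(\<Sum>i<n. \<Sum>j<n. B $$ (i, j) *\<^sub>R y k j) = (\<Sum>j<n. y k j)"
      by (subst sum.swap) (simp add: scaleR_sum_left[symmetric] colB)
    then have "(\<Sum>i<n. x (Suc k) i + y (Suc k) i)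
        = (\<Sum>i<n. x k i) + (\<Sum>i<n. y k i) - \<alpha> k *\<^sub>R (\<Sum>i<n. g k i)"
      by (simp add: x y sum.distrib sum_subtractf scaleR_sum_right)
    then show ?thesis by (simp add: zb_def sum.distrib scaleR_diff_right)
  qed
  \<comment> \<open>With entry sum 0 at every step, the rank one correction in \<open>?D\<close>
    acts as 0 on \<open>d k\<close>, so the recursion of \<open>M\<close> is one of
    \<open>?D\<close>.\<close>
  have sum_d: "(\<Sum>j<n + n. d k j) = 0" for k
  proof -
    have "real n *\<^sub>R zb k = (\<Sum>i<n. x k i) + (\<Sum>i<n. y k i)" using n by (simp add: zb_def)
    then show ?thesis
      by (simp add: sum_lessThan_add_split d_def stacked_def sum_subtractf sum_constant_scaleR del: sum_constant)
  qed
  have Ad: "(\<Sum>j<n. A $$ (i, j) *\<^sub>R d k j) = (\<Sum>j<n. A $$ (i, j) *\<^sub>R x k j) - zb k" if "i < n" for k i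
    using rowA[OF that]
    by (simp add: d_def stacked_def scaleR_diff_right sum_subtractf scaleR_sum_left[symmetric])
  have d_Suc: "d (Suc k) i = (\<Sum>j<n + n. ?D $$ (i, j) *\<^sub>R d k j) - \<alpha> k *\<^sub>R h k i" if i: "i < n + n" for k i
  proof (cases "i < n")
    case True
    show ?thesis
      unfolding deviation_matrix_apply(1)[OF A B True] sum_d Ad[OF True] using True
      by (simp add: d_def h_def stacked_def x zb_Suc scaleR_diff_right)
  next
    case False
    define l where "l = i - n"
    have l: "l < n" "i = n + l" using False i by (auto simp: l_def)
    show ?thesis
      unfolding l(2) deviation_matrix_apply(2)[OF A B l(1)] Ad[OF l(1)] using l(1)
      by (simp add: d_def h_def stacked_def y)
  qed
  have gD: "norm (g k i) \<le> D" if "i < n" for k i using assms(6)[OF that g[OF that]] .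
  have D0: "0 \<le> D" using gD[OF n] norm_ge_zero order_trans by blast
  have hD: "norm (h k i) \<le> D + D" for k i
  proof (cases "i < n")
    case True
    have "norm (\<Sum>j<n. g k j) \<le> (\<Sum>j<n. D)" using gD by (intro sum_norm_le) simp
    then have "norm ((1 / n) *\<^sub>R (\<Sum>j<n. g k j)) \<le> D" using n by (simp add: field_simps)
    with gD[OF True] have "norm (g k i) + norm ((1 / n) *\<^sub>R (\<Sum>j<n. g k j)) \<le> D + D"
      by (rule add_mono)
    then show ?thesis
      using norm_triangle_ineq4[of "g k i" "(1 / n) *\<^sub>R (\<Sum>j<n. g k j)"] True by (simp add: h_def)
  qed (use D0 in \<open>simp add: h_def\<close>)
  obtain C \<gamma> where decay: "0 \<le> C" "0 \<le> \<gamma>" "\<gamma> < 1"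
    "\<And>k i j. \<lbrakk>i < n + n; j < n + n\<rbrakk> \<Longrightarrow> \<bar>(?D ^\<^sub>m k) $$ (i, j)\<bar> \<le> C * \<gamma> ^ k"
    using geometric_power_bound[OF D _ deviation_matrix_eigenvalues[OF assms(1-4) \<epsilon>]] n by auto
  obtain E where E: "\<And>k i. i < n + n \<Longrightarrow> norm (d k i) \<le> E k" "summable (\<lambda>k. (E k)\<^sup>2)"
    using linear_recursion_square_summable[OF D decay d_Suc assms(11,13) hD] by blast
  have near: "norm (x k i - zb k) \<le> E k" if "i < n" for k i
    using E(1)[of i k] that by (simp add: d_def stacked_def)
  obtain xs where xs: "F xs = fstar" using assms(8) by blast
  have "(\<lambda>k. F (x k i)) \<longlonglongrightarrow> fstar"
    by (rule distributed_subgradient_convergence[OF n assms(5,6,7) xs assms(9,11-13) g zb_Suc near E(2) i])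
  then show "(\<lambda>k. F (z k i)) \<longlonglongrightarrow> fstar" using i by (simp add: assms(15) stacked_def)
qed

end
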